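(* Let $k\ge 2$ be a fixed integer. Then, as $n\to\infty$, \[ \mathrm{ex}(n,K_3,\widehat{C}_{2k}) = o\!\left(n^{2+\frac 1k}\right). \]
   Context: For graphs $T$ and $H$ (with no isolated vertices) and a positive integer $n$, the generalized Turán number $\mathrm{ex}(n,T,H)$ is the maximum number of copies of $T$ (subgraphs isomorphic to $T$, not necessarily induced) in an $n$-vertex graph that contains no subgraph isomorphic to $H$. For a graph $H$, its suspension $\widehat{H}$ is the graph obtained from $H$ by adding one new vertex adjacent to all vertices of $H$. $C_{2k}$ denotes the cycle of length $2k$ and $K_3$ the triangle. *)

theory Defs
  imports Complex_Main "HOL-Library.Landau_Symbols"
begin

record 'a ugraph =
  verts :: "'a set"
  edges :: "'a set set"

definition simple_graph :: "'a ugraph \<Rightarrow> bool" where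
  "simple_graph G \<longleftrightarrow> finite (verts G) \<and> (\<forall>e \<in> edges G. e \<subseteq> verts G \<and> card e = 2)"

text \<open>Subgraphs are not required to be induced.\<close>

definition subgraph :: "'a ugraph \<Rightarrow> 'a ugraph \<Rightarrow> bool" where
  "subgraph S G \<longleftrightarrow> simple_graph S \<and> verts S \<subseteq> verts G \<and> edges S \<subseteq> edges G"

definition isomorphic :: "'a ugraph \<Rightarrow> 'b ugraph \<Rightarrow> bool" where
  "isomorphic G H \<longleftrightarrow>
     (\<exists>f. bij_betw f (verts G) (verts H) \<and> edges H = (\<lambda>e. f ` e) ` edges G)"

definition copies :: "'b ugraph \<Rightarrow> 'a ugraph \<Rightarrow> 'a ugraph set" where
  "copies T G = {S. subgraph S G \<and> isomorphic T S}"

definition contains_copy :: "'a ugraph \<Rightarrow> 'b ugraph \<Rightarrow> bool" where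
  "contains_copy G H \<longleftrightarrow> copies H G \<noteq> {}"

text \<open>
  Every finite graph is isomorphic to one whose vertices are natural numbers, so
  it suffices to let the host graph range over those. If H has an edge, the set
  below is finite and nonempty, and its maximum is meaningful.
\<close>

definition gen_turan :: "nat \<Rightarrow> 'b ugraph \<Rightarrow> 'c ugraph \<Rightarrow> nat" where
  "gen_turan n T H =
     Max {card (copies T G) | G :: nat ugraph.
            simple_graph G \<and> card (verts G) = n \<and> \<not> contains_copy G H}"

definition complete_graph :: "nat \<Rightarrow> nat ugraph" where
  "complete_graph m = \<lparr>verts = {..<m}, edges = {e. e \<subseteq> {..<m} \<and> card e = 2}\<rparr>"

text \<open>This is the cycle of length m only for m at least 3.\<close>

definition cycle_graph :: "nat \<Rightarrow> nat ugraph" where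
  "cycle_graph m = \<lparr>verts = {..<m}, edges = {{i, (i + 1) mod m} | i. i < m}\<rparr>"

text \<open>The added vertex is None; the vertices of the original graph are tagged with Some.\<close>

definition suspension :: "'a ugraph \<Rightarrow> 'a option ugraph" where
  "suspension H =
     \<lparr>verts = insert None (Some ` verts H),
      edges = (\<lambda>e. Some ` e) ` edges H \<union> {{None, Some v} | v. v \<in> verts H}\<rparr>"

lemma simple_graph_complete_graph: "simple_graph (complete_graph m)"
  by (auto simp: simple_graph_def complete_graph_def)

lemma simple_graph_cycle_graph:
  assumes "m \<ge> 3"
  shows "simple_graph (cycle_graph m)"
proof -
  have "i \<noteq> (i + 1) mod m" if "i < m" for i
    using that assms by (cases "i + 1 = m") auto
  then show ?thesis
    using assms by (auto simp: simple_graph_def cycle_graph_def card_2_iff)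
qed

lemma simple_graph_suspension:
  assumes "simple_graph H"
  shows "simple_graph (suspension H)"
  using assms by (auto simp: simple_graph_def suspension_def card_image)

lemma finite_copies:
  assumes "simple_graph G"
  shows "finite (copies T G)" and "card (copies T G) \<le> 2 ^ card (verts G) * 2 ^ (2 ^ card (verts G))"
proof -
  let ?P = "Pow (verts G) \<times> Pow (Pow (verts G))"
  have fin: "finite (verts G)"
    using assms by (simp add: simple_graph_def)
  have sub: "copies T G \<subseteq> (\<lambda>(V, E). \<lparr>verts = V, edges = E\<rparr>) ` ?P"
  proof
    fix S assume "S \<in> copies T G"
    then have "(verts S, edges S) \<in> ?P"
      using assms by (auto simp: copies_def subgraph_def simple_graph_def)
    moreover have "S = (\<lambda>(V, E). \<lparr>verts = V, edges = E\<rparr>) (verts S, edges S)"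
      by simp
    ultimately show "S \<in> (\<lambda>(V, E). \<lparr>verts = V, edges = E\<rparr>) ` ?P"
      by (rule rev_image_eqI)
  qed
  show "finite (copies T G)"
    using fin by (intro finite_subset[OF sub]) auto
  have "card (copies T G) \<le> card ?P"
    using fin by (intro surj_card_le[OF _ sub]) auto
  then show "card (copies T G) \<le> 2 ^ card (verts G) * 2 ^ (2 ^ card (verts G))"
    using fin by (simp add: card_cartesian_product card_Pow)
qed

lemma gen_turan_well_defined:
  fixes T :: "'b ugraph" and H :: "'c ugraph"
  assumes "edges H \<noteq> {}"
  defines "A \<equiv> \<lambda>n. {card (copies T G) | G :: nat ugraph.
             simple_graph G \<and> card (verts G) = n \<and> \<not> contains_copy G H}"
  shows "finite (A n)" and "A n \<noteq> {}"
proof -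
  have "A n \<subseteq> {..2 ^ n * 2 ^ (2 ^ n)}"
    using finite_copies(2) by (fastforce simp: A_def)
  then show "finite (A n)"
    by (rule finite_subset) simp
  define G :: "nat ugraph" where "G = \<lparr>verts = {..<n}, edges = {}\<rparr>"
  have "simple_graph G" "card (verts G) = n"
    by (auto simp: G_def simple_graph_def)
  moreover have "\<not> contains_copy G H"
    using assms by (auto simp: G_def contains_copy_def copies_def subgraph_def isomorphic_def)
  ultimately show "A n \<noteq> {}"
    unfolding A_def by blast
qed

end

theory Submission
  imports Defs
begin

text \<open>
  If a graph on \<open>n\<close> vertices has no suspension of the cycle of length \<open>2 * k\<close>, every vertex link is
  free of that cycle and so has \<open>O(n powr (1 + 1 / k))\<close> edges.  This alone gives \<open>O(n powr (2 + 1 / k))\<close>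
  triangles.  Links being that sparse, regularity provides a set \<open>R\<close> of at most \<open>\<eta>\<^sup>2 * n\<^sup>2\<close> edges that
  meets every triangle: otherwise a regular triple of dense pairs contains a vertex with a link of
  quadratically many edges.  Apart from \<open>\<eta> * n\<close> exceptional vertices, each vertex \<open>x\<close> has a set \<open>U\<close>
  of at most \<open>\<eta> * n\<close> neighbours along \<open>R\<close>, and a triangle at \<open>x\<close> with an edge of \<open>R\<close> at \<open>x\<close> is an edge
  of the link of \<open>x\<close> that touches \<open>U\<close>.  In a graph without cycles of length \<open>2 * k\<close> there are only
  \<open>O(n * (\<eta> * n) powr (1 / k))\<close> such edges.
\<close>

section \<open>Even cycles\<close>

text \<open>The bound for a whole link is never improved. The gain comes from charging every
  triangle to one of its edges in \<open>R\<close>, so that in the link of \<open>x\<close> only the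
  edges that touch \<open>U\<close> are counted. Their number scales with \<open>card U\<close> to
  the power \<open>1 / k\<close>, so the factor saved is \<open>\<eta> powr (1 / k)\<close> up to a
  constant, and this tends to 0 with \<open>\<eta>\<close> because \<open>k\<close> is fixed. As
  \<open>\<eta>\<close> is chosen before \<open>n\<close> grows, regularity with any dependence on
  \<open>\<eta>\<close> will do. The hypothesis \<open>2 \<le> k\<close> makes
  \<open>n powr (1 + 1 / k)\<close> of smaller order than \<open>n\<^sup>2\<close>, which is what
  rules out a link with quadratically many edges.

  Graphs appear as a symmetric relation restricted to vertex sets, and edges are counted as ordered
  pairs: links, tree levels, cells of a partition and the set \<open>R\<close> are all restrictions
  of this kind. An edge inside a set therefore counts twice.\<close>

definition edge_pairs :: "('a \<Rightarrow> 'a \<Rightarrow> bool) \<Rightarrow> 'a set \<Rightarrow> 'a set \<Rightarrow> ('a \<times> 'a) set" where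
  "edge_pairs E A B = {(x, y). x \<in> A \<and> y \<in> B \<and> E x y}"

lemma edge_pairs_subset: "edge_pairs E A B \<subseteq> A \<times> B"
  by (auto simp: edge_pairs_def)

lemma finite_edge_pairs [simp]: "finite A \<Longrightarrow> finite B \<Longrightarrow> finite (edge_pairs E A B)"
  by (rule finite_subset[OF edge_pairs_subset]) simp

lemma edge_pairs_mono: "A \<subseteq> A' \<Longrightarrow> B \<subseteq> B' \<Longrightarrow> edge_pairs E A B \<subseteq> edge_pairs E A' B'"
  by (auto simp: edge_pairs_def)

lemma card_edge_pairs_mono:
  "finite A' \<Longrightarrow> finite B' \<Longrightarrow> A \<subseteq> A' \<Longrightarrow> B \<subseteq> B' \<Longrightarrow>
    card (edge_pairs E A B) \<le> card (edge_pairs E A' B')"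
  by (intro card_mono edge_pairs_mono finite_edge_pairs)

lemma card_edge_pairs:
  assumes "finite A" "finite B"
  shows "card (edge_pairs E A B) = (\<Sum>x\<in>A. card {y\<in>B. E x y})"
proof -
  have "edge_pairs E A B = (SIGMA x:A. {y\<in>B. E x y})"
    by (auto simp: edge_pairs_def)
  then show ?thesis
    using assms by (simp add: card_SigmaI)
qed

lemma card_edge_pairs_commute:
  assumes "symp E"
  shows "card (edge_pairs E A B) = card (edge_pairs E B A)"
proof -
  have "edge_pairs E A B = prod.swap ` edge_pairs E B A"
    using assms by (auto simp: edge_pairs_def dest: sympD)
  then show ?thesis by (simp add: card_image)
qed

section \<open>Cycles, cuts and subgraphs of large minimum degree\<close>

definition has_cycle :: "'a set \<Rightarrow> ('a \<Rightarrow> 'a \<Rightarrow> bool) \<Rightarrow> nat \<Rightarrow> bool" where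
  "has_cycle V E m \<longleftrightarrow>
     (\<exists>xs. length xs = m \<and> distinct xs \<and> set xs \<subseteq> V \<and> successively E xs \<and> E (last xs) (hd xs))"

lemma has_cycle_mono:
  assumes "has_cycle V E m" "V \<subseteq> V'" "\<And>u v. E u v \<Longrightarrow> E' u v"
  shows "has_cycle V' E' m"
proof -
  obtain xs where xs: "length xs = m" "distinct xs" "set xs \<subseteq> V" "successively E xs" "E (last xs) (hd xs)"
    using assms(1) by (auto simp: has_cycle_def)
  have "successively E' xs" using xs(4) assms(3) by (rule successively_mono)
  then show ?thesis using xs assms(2,3) unfolding has_cycle_def by blast
qed

text \<open>Deleting a vertex of degree at most \<open>D\<close> costs at most \<open>2 * D\<close>
  ordered pairs, so the density hypothesis survives. Being strict, it fails for the empty set, so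
  the deletions stop before that.\<close>

lemma dense_imp_min_degree_subset:
  assumes "finite V" "symp E" "2 * D * card V < card (edge_pairs E V V)"
  shows "\<exists>H\<subseteq>V. H \<noteq> {} \<and> (\<forall>v\<in>H. D < card {u\<in>H. E v u})"
  using assms(1,3)
proof (induction V rule: finite_psubset_induct)
  case (psubset V)
  show ?case
  proof (cases "\<forall>v\<in>V. D < card {u\<in>V. E v u}")
    case True
    moreover have "V \<noteq> {}"
      using psubset.prems by (auto simp: edge_pairs_def)
    ultimately show ?thesis by blast
  next
    case False
    then obtain v where v: "v \<in> V" "card {u\<in>V. E v u} \<le> D" by (auto simp: not_less)
    define W where "W = V - {v}"
    have W: "W \<subset> V" "finite W" "card V = Suc (card W)"
      using v psubset.hyps card_Suc_Diff1[of V v] by (auto simp: W_def)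
    have "edge_pairs E V V \<subseteq> edge_pairs E W W \<union> edge_pairs E {v} V \<union> edge_pairs E V {v}"
      by (auto simp: edge_pairs_def W_def)
    then have "card (edge_pairs E V V) \<le> card (edge_pairs E W W \<union> edge_pairs E {v} V \<union> edge_pairs E V {v})"
      using psubset.hyps W by (intro card_mono) auto
    also have "\<dots> \<le> card (edge_pairs E W W) + card (edge_pairs E {v} V) + card (edge_pairs E V {v})"
      by (meson add_mono card_Un_le le_trans order_refl)
    also have "card (edge_pairs E V {v}) = card (edge_pairs E {v} V)"
      by (rule card_edge_pairs_commute[OF assms(2)])
    also have "card (edge_pairs E {v} V) = card {u\<in>V. E v u}"
      using psubset.hyps by (simp add: card_edge_pairs)
    finally have "2 * D * card W < card (edge_pairs E W W)"
      using psubset.prems v W by simp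
    with psubset.IH[OF W(1)] W(1) show ?thesis by blast
  qed
qed

text \<open>Greedy: each new vertex \<open>x\<close> joins the side with fewer of its earlier
  neighbours, so at least half of the new edges cross.\<close>

lemma max_cut:
  assumes "finite V" "symp E" "irreflp E"
  shows "\<exists>S. card (edge_pairs E V V) \<le> 2 * card (edge_pairs (\<lambda>u v. E u v \<and> (u \<in> S) \<noteq> (v \<in> S)) V V)"
  using assms(1)
proof (induction V)
  case empty
  then show ?case by (auto simp: edge_pairs_def)
next
  case (insert x V)
  then obtain S0 where S0: "card (edge_pairs E V V)
      \<le> 2 * card (edge_pairs (\<lambda>u v. E u v \<and> (u \<in> S0) \<noteq> (v \<in> S0)) V V)" by blast
  let ?A = "{u\<in>V. E x u \<and> u \<in> S0}" and ?B = "{u\<in>V. E x u \<and> u \<notin> S0}"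
  define S where "S = (if card ?A \<le> card ?B then insert x S0 else S0 - {x})"
  define F where "F = (\<lambda>u v. E u v \<and> (u \<in> S) \<noteq> (v \<in> S))"
  have S_V: "v \<in> S \<longleftrightarrow> v \<in> S0" if "v \<in> V" for v
    using that insert.hyps by (auto simp: S_def)
  have symF: "symp F" using assms(2) by (auto simp: F_def symp_def)
  have split: "card (edge_pairs G (insert x V) (insert x V)) = card (edge_pairs G V V) + 2 * card {u\<in>V. G x u}"
    if G: "symp G" "\<not> G x x" for G
  proof -
    have "edge_pairs G (insert x V) (insert x V) = edge_pairs G V V \<union> (edge_pairs G {x} V \<union> edge_pairs G V {x})"
      using G(2) by (auto simp: edge_pairs_def)
    also have "card \<dots> = card (edge_pairs G V V) + card (edge_pairs G {x} V \<union> edge_pairs G V {x})"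
      using insert.hyps by (intro card_Un_disjoint finite_UnI finite_edge_pairs) (auto simp: edge_pairs_def)
    also have "card (edge_pairs G {x} V \<union> edge_pairs G V {x}) = card (edge_pairs G {x} V) + card (edge_pairs G V {x})"
      using insert.hyps by (intro card_Un_disjoint finite_UnI finite_edge_pairs) (auto simp: edge_pairs_def)
    also have "card (edge_pairs G V {x}) = card (edge_pairs G {x} V)"
      by (rule card_edge_pairs_commute[OF G(1)])
    also have "card (edge_pairs G {x} V) = card {u\<in>V. G x u}"
      using insert.hyps by (simp add: card_edge_pairs)
    finally show ?thesis by simp
  qed
  have "edge_pairs (\<lambda>u v. E u v \<and> (u \<in> S0) \<noteq> (v \<in> S0)) V V = edge_pairs F V V"
    using S_V by (auto simp: edge_pairs_def F_def)
  moreover have "card {u\<in>V. E x u} \<le> 2 * card {u\<in>V. F x u}"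
  proof -
    have "card {u\<in>V. E x u} = card (?A \<union> ?B)"
      by (rule arg_cong[where f = card]) auto
    also have "\<dots> = card ?A + card ?B"
      using insert.hyps by (intro card_Un_disjoint) auto
    also have "\<dots> \<le> 2 * card {u\<in>V. F x u}"
    proof (cases "card ?A \<le> card ?B")
      case True
      then have "{u\<in>V. F x u} = ?B"
        using S_V by (auto simp: F_def S_def)
      with True show ?thesis by simp
    next
      case False
      then have "{u\<in>V. F x u} = ?A"
        using S_V by (auto simp: F_def S_def)
      with False show ?thesis by simp
    qed
    finally show ?thesis .
  qed
  moreover have "\<not> E x x" using assms(3) by (auto dest: irreflpD)
  ultimately have "card (edge_pairs E (insert x V) (insert x V)) \<le> 2 * card (edge_pairs F (insert x V) (insert x V))"
    using S0 split[OF assms(2)] split[OF symF] by (simp add: F_def)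
  then show ?case unfolding F_def by blast
qed

text \<open>The path grows at its head, so its last vertex stays \<open>c\<close>. A vertex of
  \<open>H\<close> has more neighbours in \<open>H\<close> than the path built so far and
  \<open>X\<close> can block together. The parameter \<open>m\<close> counts edges, hence the length
  \<open>Suc m\<close>.\<close>

lemma greedy_path:
  assumes "finite H" "symp E" and deg: "\<And>v. v \<in> H \<Longrightarrow> D < card {u\<in>H. E v u}"
    and "c \<in> H" "c \<notin> X" "finite X" "card X + m \<le> D"
  shows "\<exists>xs. length xs = Suc m \<and> last xs = c \<and> distinct xs \<and> successively E xs \<and> set xs \<subseteq> H - X"
  using assms(7)
proof (induction m)
  case 0
  have "length [c] = Suc 0 \<and> last [c] = c \<and> distinct [c] \<and> successively E [c] \<and> set [c] \<subseteq> H - X"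
    using assms by simp
  then show ?case by blast
next
  case (Suc m)
  then obtain xs where xs: "length xs = Suc m" "last xs = c" "distinct xs" "successively E xs" "set xs \<subseteq> H - X"
    by auto
  then have "xs \<noteq> []" by auto
  then have "hd xs \<in> H" using xs(5) by (meson DiffD1 hd_in_set subsetD)
  have "card (set xs \<union> X) \<le> Suc m + card X"
    using card_Un_le[of "set xs" X] xs by (simp add: distinct_card)
  then have "card (set xs \<union> X) < card {u\<in>H. E (hd xs) u}"
    using deg[OF \<open>hd xs \<in> H\<close>] Suc.prems by simp
  then have "\<not> {u\<in>H. E (hd xs) u} \<subseteq> set xs \<union> X"
    using assms(6) by (meson card_mono finite_Un finite_set not_less)
  then obtain u where u: "u \<in> H" "E (hd xs) u" "u \<notin> set xs" "u \<notin> X" by blast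
  then have "E u (hd xs)" using assms(2) by (auto dest: sympD)
  then have "length (u # xs) = Suc (Suc m) \<and> last (u # xs) = c \<and> distinct (u # xs) \<and>
      successively E (u # xs) \<and> set (u # xs) \<subseteq> H - X"
    using xs u \<open>xs \<noteq> []\<close> by (auto simp: successively_Cons)
  then show ?case by blast
qed

lemma successively_alternating:
  assumes "successively E xs" "xs \<noteq> []"
    and "\<And>u v. u \<in> set xs \<Longrightarrow> v \<in> set xs \<Longrightarrow> E u v \<Longrightarrow> P u \<noteq> P v"
  shows "P (hd xs) = (P (last xs) = odd (length xs))"
  using assms
proof (induction xs rule: induct_list012)
  case (3 x y zs)
  have "P (hd (y # zs)) = (P (last (y # zs)) = odd (length (y # zs)))"
    using 3 by (intro "3.IH"(2)) auto
  moreover have "P x \<noteq> P y" using "3.prems"(1) by (intro "3.prems"(3)) auto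
  ultimately show ?case by auto
qed auto

text \<open>A breadth-first search tree of a bipartite graph: the lack of odd cycles enters through
  the requirement that every edge joins consecutive levels.\<close>

locale level_tree =
  fixes R :: "'a set" and E :: "'a \<Rightarrow> 'a \<Rightarrow> bool" and lev :: "'a \<Rightarrow> nat" and par :: "'a \<Rightarrow> 'a"
  assumes finite_R: "finite R"
    and sym_E: "symp E"
    and par: "v \<in> R \<Longrightarrow> 0 < lev v \<Longrightarrow> par v \<in> R \<and> E v (par v) \<and> Suc (lev (par v)) = lev v"
    and root_unique: "u \<in> R \<Longrightarrow> v \<in> R \<Longrightarrow> lev u = 0 \<Longrightarrow> lev v = 0 \<Longrightarrow> u = v"
    and lev_edge: "u \<in> R \<Longrightarrow> v \<in> R \<Longrightarrow> E u v \<Longrightarrow> lev v = Suc (lev u) \<or> lev u = Suc (lev v)"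
begin

lemma lev_neighbour:
  assumes "u \<in> H" "v \<in> H" "E u v" "H \<subseteq> R" "\<And>w. w \<in> H \<Longrightarrow> lev w = i \<or> lev w = Suc i"
  shows "lev v = i \<longleftrightarrow> lev u = Suc i" "lev v = Suc i \<longleftrightarrow> lev u = i"
proof -
  have "lev v = Suc (lev u) \<or> lev u = Suc (lev v)"
    using assms(1-4) by (intro lev_edge) auto
  then show "lev v = i \<longleftrightarrow> lev u = Suc i" "lev v = Suc i \<longleftrightarrow> lev u = i"
    using assms(5)[OF assms(1)] assms(5)[OF assms(2)] by linarith+
qed

lemma ancestor:
  assumes "v \<in> R" "j \<le> lev v"
  shows "(par ^^ j) v \<in> R" "lev ((par ^^ j) v) = lev v - j"
proof -
  have "(par ^^ j) v \<in> R \<and> lev ((par ^^ j) v) = lev v - j"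
    using assms(2)
  proof (induction j)
    case (Suc j)
    then show ?case using par[of "(par ^^ j) v"] by auto
  qed (use assms in auto)
  then show "(par ^^ j) v \<in> R" "lev ((par ^^ j) v) = lev v - j" by auto
qed

lemma ancestor_eq_mono:
  assumes "(par ^^ j) a = (par ^^ j) b" "j \<le> h"
  shows "(par ^^ h) a = (par ^^ h) b"
proof -
  have "(par ^^ h) x = (par ^^ (h - j)) ((par ^^ j) x)" for x
    using assms(2) by (simp flip: funpow_add[THEN fun_cong, unfolded comp_def])
  then show ?thesis using assms(1) by simp
qed

text \<open>\<open>P\<close> stays on levels \<open>i\<close> and above, while the tree branches
  stay on levels up to \<open>i\<close> and meet level \<open>i\<close> only in \<open>a\<close>, so
  they avoid \<open>P\<close>. The branches avoid each other because \<open>neq\<close> makes the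
  ancestor \<open>Suc h\<close> steps away the first common one.\<close>

lemma cycle_through_ancestor:
  assumes a: "a \<in> R" "lev a = i" and b: "b \<in> R" "lev b = i" and h: "Suc h \<le> i"
    and eq: "(par ^^ Suc h) a = (par ^^ Suc h) b" and neq: "(par ^^ h) a \<noteq> (par ^^ h) b"
    and P: "set P \<subseteq> R" "\<And>v. v \<in> set P \<Longrightarrow> i \<le> lev v" "distinct P" "successively E P" "P \<noteq> []"
      "hd P = b" "E (last P) a" "a \<notin> set P"
  shows "has_cycle R E (length P + 2 * Suc h)"
proof -
  \<comment> \<open>The cycle follows \<open>P\<close> from \<open>b\<close>, enters
    \<open>a\<close>, climbs to \<open>(par ^^ h) a\<close> and returns through the common ancestor
    to \<open>par b\<close>. The shift by one in \<open>down\<close> drops \<open>b\<close>, which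
    \<open>P\<close> contains, and adds the common ancestor, which \<open>up\<close> lacks.\<close>
  define up where "up = map (\<lambda>j. (par ^^ j) a) [0..<Suc h]"
  define down where "down = map (\<lambda>j. (par ^^ Suc j) b) [0..<Suc h]"
  define xs where "xs = P @ up @ rev down"
  have edge: "E ((par ^^ j) v) ((par ^^ Suc j) v)" if "v \<in> R" "lev v = i" "j < i" for v j
    using par[of "(par ^^ j) v"] ancestor[of v j] that by auto
  have up: "successively E up" "hd up = a" "last up = (par ^^ h) a" "up \<noteq> []" "length up = Suc h"
    using edge a h by (auto simp: up_def successively_conv_nth hd_map last_map simp del: upt_Suc)
  have down: "successively E (rev down)" "last (rev down) = par b" "hd (rev down) = (par ^^ Suc h) b"
     "down \<noteq> []" "length down = Suc h"
  proof -
    have "E ((par ^^ Suc j) b) ((par ^^ Suc (Suc j)) b)" if "j < h" for j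
      using b h that by (intro edge) auto
    then have "successively E down"
      by (auto simp: down_def successively_conv_nth simp del: upt_Suc funpow.simps)
    then show "successively E (rev down)"
      using sym_E by (simp add: successively_rev) (metis (mono_tags, lifting) successively_mono sympD)
    show "last (rev down) = par b" "hd (rev down) = (par ^^ Suc h) b" "down \<noteq> []" "length down = Suc h"
      by (auto simp: down_def last_rev hd_rev hd_map last_map simp del: upt_Suc)
  qed
  have up_elem: "v \<in> R \<and> lev v \<le> i \<and> (lev v = i \<longrightarrow> v = a)" if "v \<in> set up" for v
  proof -
    have "v \<in> (\<lambda>j. (par ^^ j) a) ` {0..<Suc h}"
      using that unfolding up_def set_map set_upt .
    then obtain j where "j \<in> {0..<Suc h}" "v = (par ^^ j) a" by (elim imageE)
    then have j: "j \<le> h" "v = (par ^^ j) a" by simp_all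
    then have "v \<in> R" "lev v = i - j" using ancestor[of a j] a h by simp_all
    then show ?thesis using j h by (cases j) auto
  qed
  have down_elem: "v \<in> R \<and> lev v < i" if "v \<in> set down" for v
  proof -
    have "v \<in> (\<lambda>j. (par ^^ Suc j) b) ` {0..<Suc h}"
      using that unfolding down_def set_map set_upt .
    then obtain j where "j \<in> {0..<Suc h}" "v = (par ^^ Suc j) b" by (elim imageE)
    then have j: "j \<le> h" "v = (par ^^ Suc j) b" by simp_all
    then show ?thesis using ancestor[of b "Suc j"] b h by (simp del: funpow.simps)
  qed
  have anc_inj: "x = y" if "v \<in> R" "lev v = i" "x \<le> i" "y \<le> i" "(par ^^ x) v = (par ^^ y) v" for v x y
  proof -
    have "i - x = i - y" using that ancestor(2)[of v x] ancestor(2)[of v y] by simp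
    then show ?thesis using that by linarith
  qed
  have dist_up: "distinct up"
    using anc_inj[of a] a h by (auto simp: up_def distinct_map inj_on_def simp del: upt_Suc)
  have "inj_on (\<lambda>j. (par ^^ Suc j) b) {0..<Suc h}"
  proof (rule inj_onI)
    fix x y assume "x \<in> {0..<Suc h}" "y \<in> {0..<Suc h}" "(par ^^ Suc x) b = (par ^^ Suc y) b"
    then show "x = y" using anc_inj[of b "Suc x" "Suc y"] b h by (simp del: funpow.simps)
  qed
  then have dist_down: "distinct down"
    by (simp add: down_def distinct_map del: upt_Suc funpow.simps)
  have disj_up_down: "set up \<inter> set down = {}"
  proof (rule ccontr)
    assume "set up \<inter> set down \<noteq> {}"
    then obtain v where "v \<in> (\<lambda>j. (par ^^ j) a) ` {0..<Suc h}" "v \<in> (\<lambda>j. (par ^^ Suc j) b) ` {0..<Suc h}"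
      unfolding up_def down_def set_map set_upt by (meson disjoint_iff)
    then obtain x y where "x \<in> {0..<Suc h}" "y \<in> {0..<Suc h}" and e: "(par ^^ x) a = (par ^^ Suc y) b"
      by (elim imageE) metis
    then have xy: "x \<le> h" "y \<le> h" by simp_all
    \<comment> \<open>A common vertex has a single level, so it is reached from \<open>a\<close> and
      from \<open>b\<close> in equally many steps. The ancestors then still agree at step
      \<open>h\<close>, against \<open>neq\<close>.\<close>
    have "i - x = i - Suc y"
      using ancestor(2)[of a x] ancestor(2)[of b "Suc y"] a b xy h e by simp
    then have "x = Suc y" using xy h by auto
    with e have "(par ^^ x) a = (par ^^ x) b" by (simp only:)
    from ancestor_eq_mono[OF this xy(1)] neq show False by (rule notE[rotated])
  qed
  have "distinct xs"
  proof -
    have "v \<notin> set up" "v \<notin> set down" if "v \<in> set P" for v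
      using P(2)[OF that] P(8) that up_elem[of v] down_elem[of v] by auto
    then have "set P \<inter> set up = {}" "set P \<inter> set down = {}" by blast+
    then show ?thesis
      using P(3) dist_up dist_down disj_up_down unfolding xs_def distinct_append set_append set_rev distinct_rev
      by (simp only: Int_Un_distrib) simp
  qed
  moreover have "set xs \<subseteq> R"
    using P(1) up_elem down_elem by (auto simp: xs_def)
  moreover have "successively E xs"
  proof -
    have "E (last up) (hd (rev down))"
      using edge[of a h] a h up(3) down(3) eq by simp
    then show ?thesis
      using P up down by (simp add: xs_def successively_append_iff)
  qed
  moreover have "E (last xs) (hd xs)"
  proof -
    have "E b (par b)" using par[of b] b h by auto
    then show ?thesis
      using sym_E down P(5,6) by (auto simp: xs_def dest: sympD)
  qed
  moreover have "length xs = length P + 2 * Suc h"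
    using up down by (simp add: xs_def)
  ultimately show ?thesis unfolding has_cycle_def by blast
qed

text \<open>Two neighbours of a vertex \<open>c\<close> on level \<open>i + 1\<close> cannot lie below different children of the
  common ancestor: a greedy path of the right odd length out of \<open>c\<close> ends below a child that differs
  from one of the two, and the tree closes it up to a cycle of length \<open>2 * k\<close>.  Hence restricting
  to the descendants of one child preserves all degrees.\<close>

lemma no_min_degree_between_levels:
  assumes nc: "\<not> has_cycle R E (2 * k)" and "i < k"
    and "H \<subseteq> R" and "\<And>v. v \<in> H \<Longrightarrow> lev v = i \<or> lev v = Suc i"
    and "\<And>v. v \<in> H \<Longrightarrow> 2 * k < card {u\<in>H. E v u}"
  shows "H = {}"
proof -
  \<comment> \<open>Induction on \<open>h\<close>, a number of steps after which all vertices of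
    \<open>H\<close> on level \<open>i\<close> have the same ancestor. It is applied with
    \<open>h = i\<close>, where that ancestor is the root; at \<open>h = 0\<close> at most one
    vertex of \<open>H\<close> is left on level \<open>i\<close>, which contradicts the
    degrees.\<close>
  have key: "H = {}" if "h \<le> i" "H \<subseteq> R" "\<And>v. v \<in> H \<Longrightarrow> lev v = i \<or> lev v = Suc i"
    "\<And>v. v \<in> H \<Longrightarrow> 2 * k < card {u\<in>H. E v u}"
    "\<And>a b. a \<in> H \<Longrightarrow> b \<in> H \<Longrightarrow> lev a = i \<Longrightarrow> lev b = i \<Longrightarrow> (par ^^ h) a = (par ^^ h) b" for h H
    using that
  proof (induction h arbitrary: H)
    case 0
    show ?case
    proof (rule ccontr)
      assume "H \<noteq> {}"
      have nbr: "\<exists>u\<in>H. E v u" if "v \<in> H" for v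
        using "0.prems"(4)[OF that] by (metis (no_types, lifting) Collect_empty_eq card.empty less_nat_zero_code)
      obtain c where c: "c \<in> H" "lev c = Suc i"
      proof -
        obtain v where v: "v \<in> H" using \<open>H \<noteq> {}\<close> by blast
        then obtain u where u: "u \<in> H" "E v u" using nbr by blast
        then have "lev u = Suc (lev v) \<or> lev v = Suc (lev u)"
          using v "0.prems"(2) by (intro lev_edge) auto
        then have "lev v = Suc i \<or> lev u = Suc i"
          using "0.prems"(3)[OF v] "0.prems"(3)[OF u(1)] by linarith
        then show thesis using that v u(1) by blast
      qed
      have "{u\<in>H. E c u} \<subseteq> {u\<in>H. lev u = i}"
        using lev_neighbour(1)[OF c(1) _ _ "0.prems"(2,3)] c by blast
      moreover have "card {u\<in>H. lev u = i} \<le> 1"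
        using "0.prems"(5) by (intro card_le_Suc0_iff_eq[THEN iffD2, unfolded One_nat_def[symmetric]])
          (use "0.prems"(2) finite_R in \<open>auto intro: finite_subset\<close>)
      moreover have "finite {u\<in>H. lev u = i}" using "0.prems"(2) finite_R by (auto intro: finite_subset)
      ultimately have "card {u\<in>H. E c u} \<le> 1" by (meson card_mono le_trans)
      with "0.prems"(4)[OF c(1)] \<open>i < k\<close> show False by simp
    qed
  next
    case (Suc h)
    have finH: "finite H" using Suc.prems(2) finite_R by (rule finite_subset)
    have mono: "(par ^^ h) a = (par ^^ h) a'"
      if c: "c \<in> H" "lev c = Suc i" and a: "a \<in> H" "E c a" and a': "a' \<in> H" "E c a'" for c a a'
    proof (rule ccontr)
      assume neq: "(par ^^ h) a \<noteq> (par ^^ h) a'"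
      have lev_a: "lev a = i" "lev a' = i"
        using lev_neighbour(1)[OF c(1) _ _ Suc.prems(2,3)] c a a' by blast+
      \<comment> \<open>A path on \<open>Suc m\<close> vertices and two branches of
        \<open>Suc h\<close> vertices add up to \<open>2 * k\<close>. Since
        \<open>Suc h \<le> i < k\<close>, the number \<open>m\<close> is positive and odd, so a path
        that leaves \<open>c\<close> on level \<open>Suc i\<close> ends on level
        \<open>i\<close>.\<close>
      define m where "m = 2 * (k - Suc h) - 1"
      have m: "Suc m + 2 * Suc h = 2 * k" "odd m"
        using Suc.prems(1) \<open>i < k\<close> by (auto simp: m_def)
      have "card {a, a'} + m \<le> 2 * k"
        using card_2_iff[of "{a,a'}"] neq m by (auto simp: card_insert_if)
      moreover have "c \<notin> {a, a'}" using c lev_a by auto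
      ultimately obtain P where P: "length P = Suc m" "last P = c" "distinct P" "successively E P" "set P \<subseteq> H - {a, a'}"
        using greedy_path[OF finH sym_E Suc.prems(4) c(1), of "{a,a'}" m] by auto
      have Pne: "P \<noteq> []" using P(1) by auto
      have "lev (hd P) = i"
      proof -
        have "(lev (hd P) = i) = ((lev (last P) = i) = odd (length P))"
        proof (rule successively_alternating[OF P(4) Pne])
          fix u v assume "u \<in> set P" "v \<in> set P" "E u v"
          then show "(lev u = i) \<noteq> (lev v = i)"
            using lev_neighbour(1)[OF _ _ _ Suc.prems(2,3), of u v] Suc.prems(3)[of u] P(5) by fastforce
        qed
        then show ?thesis using P(1,2) c m by simp
      qed
      have hdP: "hd P \<in> H" using P(5) Pne hd_in_set by blast
      \<comment> \<open>Which of \<open>a\<close> and \<open>a'\<close> closes the cycle depends on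
        where the path ends; this is why the path has to avoid both.\<close>
      obtain a0 where a0: "a0 \<in> {a, a'}" "(par ^^ h) a0 \<noteq> (par ^^ h) (hd P)"
        using neq by (metis insertCI)
      then have a0': "a0 \<in> H" "lev a0 = i" "E c a0" using a a' lev_a by auto
      have "has_cycle R E (length P + 2 * Suc h)"
      proof (rule cycle_through_ancestor)
        show "(par ^^ Suc h) a0 = (par ^^ Suc h) (hd P)"
          by (rule Suc.prems(5)[OF a0'(1) hdP a0'(2) \<open>lev (hd P) = i\<close>])
        show "\<And>v. v \<in> set P \<Longrightarrow> i \<le> lev v" using P(5) Suc.prems(3) by fastforce
      qed (use a0 a0' hdP \<open>lev (hd P) = i\<close> P Pne Suc.prems(1,2) in auto)
      then show False using nc m P(1) by simp
    qed
    show ?case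
    proof (rule ccontr)
      assume "H \<noteq> {}"
      then obtain v where v: "v \<in> H" by blast
      have nbr: "\<exists>u\<in>H. E v u" if "v \<in> H" for v
        using Suc.prems(4)[OF that] by (metis (no_types, lifting) Collect_empty_eq card.empty less_nat_zero_code)
      obtain u where u: "u \<in> H" "E v u" using nbr[OF v] by blast
      then have "lev u = Suc (lev v) \<or> lev v = Suc (lev u)"
        using v Suc.prems(2) by (intro lev_edge) auto
      then have "lev v = i \<or> lev u = i"
        using Suc.prems(3)[OF v] Suc.prems(3)[OF u(1)] by linarith
      then obtain a where a: "a \<in> H" "lev a = i"
        using v u(1) by blast
      \<comment> \<open>\<open>H'\<close> consists of the vertices on level \<open>i\<close> with
        the same \<open>h\<close>-th ancestor as \<open>a\<close>, and of their neighbours on level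
        \<open>Suc i\<close>. By \<open>mono\<close>, no edge of \<open>H\<close> leaves
        \<open>H'\<close>.\<close>
      define H' where "H' = {v\<in>H. (lev v = i \<and> (par ^^ h) v = (par ^^ h) a) \<or>
        (lev v = Suc i \<and> (\<exists>u\<in>H. E v u \<and> (par ^^ h) u = (par ^^ h) a))}"
      have closed: "u \<in> H'" if "v \<in> H'" "u \<in> H" "E v u" for u v
      proof (cases "lev v = i")
        case True
        then have "lev u = Suc i"
          using that lev_neighbour(2)[OF _ _ _ Suc.prems(2,3), of v u] unfolding H'_def by blast
        moreover have "E u v" using that sym_E by (auto dest: sympD)
        ultimately show ?thesis using that True by (auto simp: H'_def)
      next
        case False
        note vH' = \<open>v \<in> H'\<close>
        from False obtain w where w: "lev v = Suc i" "w \<in> H" "E v w" "(par ^^ h) w = (par ^^ h) a" and vH: "v \<in> H"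
          using vH' by (auto simp: H'_def)
        then have "(par ^^ h) u = (par ^^ h) w" using mono that by blast
        moreover have "lev u = i"
          using that lev_neighbour(1)[OF _ _ _ Suc.prems(2,3), of v u] w(1) vH by blast
        ultimately show ?thesis using w that by (simp add: H'_def)
      qed
      have "H' = {}"
      proof (rule Suc.IH)
        show "h \<le> i" using Suc.prems(1) by simp
        show "H' \<subseteq> R" using Suc.prems(2) by (auto simp: H'_def)
        show "lev v = i \<or> lev v = Suc i" if "v \<in> H'" for v using that by (auto simp: H'_def)
        show "2 * k < card {u\<in>H'. E v u}" if "v \<in> H'" for v
        proof -
          have "{u\<in>H'. E v u} = {u\<in>H. E v u}"
            using closed[OF that] by (auto simp: H'_def)
          then show ?thesis using that Suc.prems(4)[of v] by (simp add: H'_def)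
        qed
      qed (auto simp: H'_def)
      moreover have "a \<in> H'" using a by (simp add: H'_def)
      ultimately show False by blast
    qed
  qed
  have root: "(par ^^ i) a = (par ^^ i) b" if "a \<in> H" "b \<in> H" "lev a = i" "lev b = i" for a b
    using that ancestor[of a i] ancestor[of b i] assms(3) by (intro root_unique) auto
  show ?thesis by (rule key[OF order_refl assms(3)], erule assms(4), erule assms(5), rule root)
qed

text \<open>Consecutive levels span few edges although all degrees are large, so each level is at
  least \<open>q\<close> times the preceding one. Of the surplus 3 in \<open>q + 3\<close>, two
  units pay for the share of a level in the edge counts on its two sides, and one pays for the
  preceding level, which by induction is no larger.\<close>

lemma level_growth:
  assumes nc: "\<not> has_cycle R E (2 * k)" and "0 < k" and "r \<in> R" "lev r = 0" and "1 \<le> q"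
    and deg: "\<And>v. v \<in> R \<Longrightarrow> 2 * k * (q + 3) \<le> card {u\<in>R. E v u}"
  shows "q ^ k \<le> card R"
proof -
  define L where "L i = {v\<in>R. lev v = i}" for i
  have finL: "finite (L i)" for i using finite_R by (simp add: L_def)
  have few: "card (edge_pairs E (L i) (L (Suc i))) \<le> 2 * k * (card (L i) + card (L (Suc i)))" if "i < k" for i
  proof (rule ccontr)
    assume neg: "\<not> ?thesis"
    let ?W = "L i \<union> L (Suc i)"
    have "card ?W = card (L i) + card (L (Suc i))"
      using finL by (intro card_Un_disjoint) (auto simp: L_def)
    \<comment> \<open>The factor 2 that \<open>dense_imp_min_degree_subset\<close> asks for comes
      from counting both orientations of each edge.\<close>
    then have "2 * (2 * k) * card ?W < 2 * card (edge_pairs E (L i) (L (Suc i)))"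
      using neg by simp
    also have "\<dots> = card (edge_pairs E (L i) (L (Suc i))) + card (edge_pairs E (L (Suc i)) (L i))"
      using card_edge_pairs_commute[OF sym_E, of "L i" "L (Suc i)"] by simp
    also have "\<dots> = card (edge_pairs E (L i) (L (Suc i)) \<union> edge_pairs E (L (Suc i)) (L i))"
      using finL by (intro card_Un_disjoint[symmetric] finite_edge_pairs) (auto simp: edge_pairs_def L_def)
    also have "\<dots> \<le> card (edge_pairs E ?W ?W)"
      using finL by (intro card_mono finite_edge_pairs finite_UnI) (auto simp: edge_pairs_def)
    finally obtain H where H: "H \<subseteq> ?W" "H \<noteq> {}" "\<forall>v\<in>H. 2 * k < card {u\<in>H. E v u}"
      using dense_imp_min_degree_subset[of ?W E "2 * k"] finL sym_E by auto
    have "H = {}"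
      using H by (intro no_min_degree_between_levels[OF nc that]) (auto simp: L_def)
    with H show False by simp
  qed
  have deg_sum: "2 * k * (q + 3) * card (L i) \<le> card (edge_pairs E (L i) R)" for i
  proof -
    have "2 * k * (q + 3) * card (L i) = (\<Sum>v\<in>L i. 2 * k * (q + 3))" by simp
    also have "\<dots> \<le> (\<Sum>v\<in>L i. card {u\<in>R. E v u})"
      using deg by (intro sum_mono) (auto simp: L_def)
    finally show ?thesis using finL finite_R by (simp add: card_edge_pairs)
  qed
  have grow: "q * card (L i) \<le> card (L (Suc i))" if "i < k" for i
    using that
  proof (induction i)
    case 0
    have "edge_pairs E (L 0) R \<subseteq> edge_pairs E (L 0) (L (Suc 0))"
      using lev_edge by (fastforce simp: edge_pairs_def L_def)
    then have "card (edge_pairs E (L 0) R) \<le> card (edge_pairs E (L 0) (L (Suc 0)))"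
      using finL by (intro card_mono) auto
    with deg_sum[of 0] few[OF \<open>0 < k\<close>]
    have "2 * k * (q + 3) * card (L 0) \<le> 2 * k * (card (L 0) + card (L (Suc 0)))"
      by linarith
    then have "(q + 3) * card (L 0) \<le> card (L 0) + card (L (Suc 0))"
      using \<open>0 < k\<close> by simp
    then show ?case by (simp add: algebra_simps)
  next
    case (Suc i)
    then have IH: "card (L i) \<le> card (L (Suc i))"
      using \<open>1 \<le> q\<close> by (metis Suc_lessD le_trans mult_1 mult_le_mono1)
    have "edge_pairs E (L (Suc i)) R \<subseteq> edge_pairs E (L (Suc i)) (L i) \<union> edge_pairs E (L (Suc i)) (L (Suc (Suc i)))"
      using lev_edge by (fastforce simp: edge_pairs_def L_def)
    then have "card (edge_pairs E (L (Suc i)) R)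
        \<le> card (edge_pairs E (L (Suc i)) (L i) \<union> edge_pairs E (L (Suc i)) (L (Suc (Suc i))))"
      using finL by (intro card_mono) auto
    also have "\<dots> \<le> card (edge_pairs E (L i) (L (Suc i))) + card (edge_pairs E (L (Suc i)) (L (Suc (Suc i))))"
      using card_Un_le card_edge_pairs_commute[OF sym_E, of "L i" "L (Suc i)"] by metis
    also have "\<dots> \<le> 2 * k * (card (L i) + card (L (Suc i))) + 2 * k * (card (L (Suc i)) + card (L (Suc (Suc i))))"
      using few[of i] few[of "Suc i"] Suc.prems by simp
    finally have "2 * k * ((q + 3) * card (L (Suc i)))
        \<le> 2 * k * (card (L i) + 2 * card (L (Suc i)) + card (L (Suc (Suc i))))"
      using deg_sum[of "Suc i"] by (simp add: algebra_simps)
    then have "(q + 3) * card (L (Suc i)) \<le> card (L i) + 2 * card (L (Suc i)) + card (L (Suc (Suc i)))"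
      using \<open>0 < k\<close> by simp
    then show ?case using IH by (simp add: algebra_simps)
  qed
  have "q ^ i \<le> card (L i)" if "i \<le> k" for i
    using that
  proof (induction i)
    case 0
    have "r \<in> L 0" using assms by (simp add: L_def)
    then have "card (L 0) > 0" using finL by (auto simp: card_gt_0_iff)
    then show ?case by simp
  next
    case (Suc i)
    then have "q * q ^ i \<le> q * card (L i)" by simp
    also have "\<dots> \<le> card (L (Suc i))" using grow Suc.prems by simp
    finally show ?case by simp
  qed
  then have "q ^ k \<le> card (L k)" by simp
  also have "\<dots> \<le> card R" using finite_R by (intro card_mono) (auto simp: L_def)
  finally show ?thesis .
qed

end

section \<open>Edge bounds for graphs without an even cycle\<close>

text \<open>Breadth-first search from \<open>r\<close> in its component. Adjacent vertices differ by
  at most one level, and the parity of the level decides the side of the bipartition, so no edge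
  stays within a level.\<close>

lemma bipartite_level_tree:
  assumes "finite V" "symp E" "r \<in> V"
    and bip: "\<And>u v. E u v \<Longrightarrow> (u \<in> S) \<noteq> (v \<in> S)"
  shows "\<exists>R lev par. level_tree R E lev par \<and> r \<in> R \<and> lev r = 0 \<and> R \<subseteq> V \<and>
    (\<forall>u\<in>R. \<forall>v\<in>V. E u v \<longrightarrow> v \<in> R)"
proof -
  \<comment> \<open>With steps confined to \<open>V\<close>, the powers of \<open>Q\<close> describe
    walks in the induced graph, and \<open>lev\<close> is the distance from \<open>r\<close> in
    it.\<close>
  define Q where "Q = (\<lambda>u v. E u v \<and> u \<in> V \<and> v \<in> V)"
  define R where "R = {v\<in>V. \<exists>n. (Q ^^ n) r v}"
  define lev where "lev v = (LEAST n. (Q ^^ n) r v)" for v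
  define par where "par v = (SOME u. u \<in> R \<and> E u v \<and> Suc (lev u) = lev v)" for v
  have lev: "(Q ^^ lev v) r v" if "v \<in> R" for v
    using that unfolding lev_def R_def by (auto intro: LeastI)
  have lev_le: "lev v \<le> n" if "(Q ^^ n) r v" for v n
    using that unfolding lev_def by (rule Least_le)
  have r: "r \<in> R" "lev r = 0"
  proof -
    have "(Q ^^ 0) r r" by simp
    then show "r \<in> R" "lev r = 0" using lev_le[of 0 r] assms(3) by (auto simp: R_def intro: exI[of _ 0])
  qed
  have step: "v \<in> R \<and> lev v \<le> Suc (lev u)" if "u \<in> R" "v \<in> V" "E u v" for u v
  proof -
    have "(Q ^^ Suc (lev u)) r v"
      using lev[OF that(1)] that by (auto simp: Q_def R_def)
    then show ?thesis using that lev_le unfolding R_def by blast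
  qed
  have par_ex: "\<exists>u. u \<in> R \<and> E u v \<and> Suc (lev u) = lev v" if "v \<in> R" "0 < lev v" for v
  proof -
    obtain n where n: "lev v = Suc n" using \<open>0 < lev v\<close> by (cases "lev v") auto
    then obtain u where u: "(Q ^^ n) r u" "Q u v" using lev[OF \<open>v \<in> R\<close>] by auto
    then have "u \<in> R" by (auto simp: R_def Q_def)
    moreover have "lev u \<le> n" using u lev_le by blast
    moreover have "lev v \<le> Suc (lev u)" using step[of u v] \<open>u \<in> R\<close> u by (auto simp: Q_def)
    ultimately show ?thesis using u n by (auto simp: Q_def)
  qed
  have par: "par v \<in> R \<and> E (par v) v \<and> Suc (lev (par v)) = lev v" if "v \<in> R" "0 < lev v" for v
    using someI_ex[OF par_ex[OF that]] unfolding par_def by blast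
  have lev0: "v = r" if "v \<in> R" "lev v = 0" for v
    using lev[OF that(1)] that(2) by simp
  have parity: "(v \<in> S) = ((r \<in> S) = even (lev v))" if "v \<in> R" for v
    using that
  proof (induction "lev v" arbitrary: v)
    case 0
    then show ?case using lev0 by auto
  next
    case (Suc n)
    then have p: "par v \<in> R" "E (par v) v" "Suc (lev (par v)) = lev v" using par[of v] by auto
    then have "even (lev v) = odd (lev (par v))" by (metis even_Suc)
    moreover have "(par v \<in> S) = ((r \<in> S) = even (lev (par v)))"
      using p Suc(2) by (intro Suc(1)) auto
    ultimately show ?case using bip[OF p(2)] by blast
  qed
  have "level_tree R E lev par"
  proof
    show "finite R" using assms(1) by (simp add: R_def)
    show "symp E" by fact
    show "par v \<in> R \<and> E v (par v) \<and> Suc (lev (par v)) = lev v" if "v \<in> R" "0 < lev v" for v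
      using par[OF that] assms(2) by (auto dest: sympD)
    show "u = v" if "u \<in> R" "v \<in> R" "lev u = 0" "lev v = 0" for u v
      using lev0 that by metis
    show "lev v = Suc (lev u) \<or> lev u = Suc (lev v)" if "u \<in> R" "v \<in> R" "E u v" for u v
    proof -
      have "E v u" using that assms(2) by (auto dest: sympD)
      then have "lev v \<le> Suc (lev u)" "lev u \<le> Suc (lev v)"
        using step[of u v] step[of v u] that by (auto simp: R_def)
      moreover have "lev u \<noteq> lev v" using bip[OF that(3)] parity that by auto
      ultimately show ?thesis by linarith
    qed
  qed
  moreover have "R \<subseteq> V" by (auto simp: R_def)
  ultimately show ?thesis using r step by blast
qed

lemma bipartite_min_degree_bound:
  assumes "finite V" "symp E" "V \<noteq> {}" and "\<And>u v. E u v \<Longrightarrow> (u \<in> S) \<noteq> (v \<in> S)"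
    and nc: "\<not> has_cycle V E (2 * k)" and "0 < k" "1 \<le> q"
    and deg: "\<And>v. v \<in> V \<Longrightarrow> 2 * k * (q + 3) \<le> card {u\<in>V. E v u}"
  shows "q ^ k \<le> card V"
proof -
  obtain r where "r \<in> V" using assms(3) by blast
  obtain R lev par where T: "level_tree R E lev par" "r \<in> R" "lev r = 0" "R \<subseteq> V"
    and closed: "\<forall>u\<in>R. \<forall>v\<in>V. E u v \<longrightarrow> v \<in> R"
    using bipartite_level_tree[OF assms(1,2) \<open>r \<in> V\<close> assms(4)] by blast
  interpret level_tree R E lev par by fact
  have "q ^ k \<le> card R"
  proof (rule level_growth[OF _ \<open>0 < k\<close> T(2,3) \<open>1 \<le> q\<close>])
    show "\<not> has_cycle R E (2 * k)" using nc has_cycle_mono[OF _ T(4)] by blast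
    show "2 * k * (q + 3) \<le> card {u\<in>R. E v u}" if "v \<in> R" for v
    proof -
      have "{u\<in>R. E v u} = {u\<in>V. E v u}" using closed that T(4) by blast
      then show ?thesis using deg that T(4) by auto
    qed
  qed
  also have "\<dots> \<le> card V" using T assms by (intro card_mono)
  finally show ?thesis .
qed

text \<open>Passing to a bipartite subgraph costs a factor 2 and passing to minimum degree
  \<open>2 * k * (q + 3)\<close> another factor 2. What remains would have at least
  \<open>q ^ k\<close> vertices by the growth of levels.\<close>

lemma even_cycle_free_edge_bound:
  assumes "finite V" "symp E" "irreflp E" and nc: "\<not> has_cycle V E (2 * k)" and "0 < k" "card V < q ^ k"
  shows "card (edge_pairs E V V) \<le> 8 * k * (q + 3) * card V"
proof (rule ccontr)
  assume neg: "\<not> ?thesis"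
  obtain S where S: "card (edge_pairs E V V) \<le> 2 * card (edge_pairs (\<lambda>u v. E u v \<and> (u \<in> S) \<noteq> (v \<in> S)) V V)"
    using max_cut assms by blast
  define F where "F = (\<lambda>u v. E u v \<and> (u \<in> S) \<noteq> (v \<in> S))"
  have symF: "symp F" using assms(2) by (auto simp: F_def symp_def)
  have "2 * (2 * k * (q + 3)) * card V < card (edge_pairs F V V)"
    using S neg by (simp add: F_def)
  then obtain H where H: "H \<subseteq> V" "H \<noteq> {}" "\<forall>v\<in>H. 2 * k * (q + 3) < card {u\<in>H. F v u}"
    using dense_imp_min_degree_subset[OF assms(1) symF] by blast
  have "1 \<le> q" using assms(5,6) by (cases q) (auto simp: power_0_left)
  have "q ^ k \<le> card H"
  proof (rule bipartite_min_degree_bound[OF _ symF H(2) _ _ \<open>0 < k\<close> \<open>1 \<le> q\<close>])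
    show "\<not> has_cycle H F (2 * k)"
    proof
      assume "has_cycle H F (2 * k)"
      then have "has_cycle V E (2 * k)"
        by (rule has_cycle_mono) (use H(1) in \<open>simp_all add: F_def\<close>)
      with nc show False ..
    qed
    show "finite H" using H(1) assms(1) by (rule finite_subset)
    show "(u \<in> S) \<noteq> (v \<in> S)" if "F u v" for u v using that by (simp add: F_def)
    show "2 * k * (q + 3) \<le> card {u\<in>H. F v u}" if "v \<in> H" for v
      using H(3) that by (meson less_imp_le)
  qed
  also have "\<dots> \<le> card V" using H assms by (intro card_mono)
  finally show False using assms by simp
qed

text \<open>The Bondy-Simonovits bound. The number \<open>n\<close> may exceed
  \<open>card V\<close>, so that all links of a graph share one bound.\<close>

lemma even_cycle_free_edge_bound_powr:
  assumes "finite V" "symp E" "irreflp E" and nc: "\<not> has_cycle V E (2 * k)" and "0 < k" "card V \<le> n"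
  shows "real (card (edge_pairs E V V)) \<le> 40 * real k * (real n * real n powr (1 / real k))"
proof (cases "n = 0")
  case True
  then have "V = {}" using assms by simp
  then show ?thesis by (simp add: edge_pairs_def)
next
  case False
  define t where "t = real n powr (1 / real k)"
  have t1: "1 \<le> t" using False \<open>0 < k\<close> by (simp add: t_def ge_one_powr_ge_zero)
  have tk: "t ^ k = real n"
    using False \<open>0 < k\<close> by (simp add: t_def powr_powr flip: powr_realpow)
  \<comment> \<open>The least integer above \<open>t\<close>, so that \<open>q ^ k\<close> exceeds
    \<open>n\<close>. Then \<open>q + 3 \<le> t + 4 \<le> 5 * t\<close>, which turns the constant 8
    into 40.\<close>
  define q where "q = nat \<lfloor>t\<rfloor> + 1"
  have q: "t < real q" "real q \<le> t + 1" using t1 by (auto simp: q_def; linarith)+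
  have "real n < real (q ^ k)"
    using power_strict_mono[OF q(1), of k] t1 \<open>0 < k\<close> tk by simp
  then have "card V < q ^ k" using assms(6) by linarith
  then have "card (edge_pairs E V V) \<le> 8 * k * (q + 3) * card V"
    using even_cycle_free_edge_bound assms by blast
  also have "\<dots> \<le> 8 * k * (q + 3) * n" using assms(6) by simp
  finally have "real (card (edge_pairs E V V)) \<le> real (8 * k * (q + 3) * n)" by (rule of_nat_mono)
  also have "\<dots> = 8 * real k * real n * (real q + 3)" by (simp add: algebra_simps)
  also have "\<dots> \<le> 8 * real k * real n * (5 * t)"
    using q t1 by (intro mult_left_mono) auto
  finally show ?thesis by (simp add: t_def algebra_simps)
qed

text \<open>Cutting \<open>W\<close> into pieces of size \<open>m\<close> shows that few vertices of a graph without \<open>2 * k\<close>-cycles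
  meet only a small proportion of the maximal number of edges.\<close>

lemma even_cycle_free_edges_touching:
  assumes "finite V" "symp E" "irreflp E" and nc: "\<not> has_cycle V E (2 * k)" and "0 < k"
    and U: "U \<subseteq> V" "card U \<le> m" "0 < m" "m \<le> n" "card V \<le> n"
  shows "real (card (edge_pairs E U V)) \<le> 320 * real k * (real n * real m powr (1 / real k))"
proof -
  \<comment> \<open>\<open>U\<close> and one piece of size at most \<open>m\<close> span at most
    \<open>2 * m\<close> vertices.\<close>
  define B where "B = 40 * real k * (real (2 * m) * real (2 * m) powr (1 / real k))"
  have piece: "real (card (edge_pairs E U W)) \<le> B" if "W \<subseteq> V" "card W \<le> m" for W
  proof -
    have fin: "finite U" "finite W" using assms that by (auto intro: finite_subset)
    have "card (edge_pairs E U W) \<le> card (edge_pairs E (U \<union> W) (U \<union> W))"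
      using fin by (intro card_edge_pairs_mono) auto
    moreover have "real (card (edge_pairs E (U \<union> W) (U \<union> W))) \<le> B"
      unfolding B_def
    proof (rule even_cycle_free_edge_bound_powr)
      show "\<not> has_cycle (U \<union> W) E (2 * k)"
        using nc has_cycle_mono[of "U \<union> W" E _ V E] that U by blast
      show "card (U \<union> W) \<le> 2 * m" using card_Un_le[of U W] U that by simp
    qed (use fin assms in auto)
    ultimately show ?thesis by linarith
  qed
  have pieces: "real (card (edge_pairs E U W)) \<le> real j * B" if "W \<subseteq> V" "card W \<le> j * m" for j W
    using that
  proof (induction j arbitrary: W)
    case 0
    then have "finite W" using assms(1) finite_subset by blast
    with 0 have "W = {}" by simp
    then show ?case by (simp add: edge_pairs_def)
  next
    case (Suc j)
    have fin: "finite W" "finite U" using Suc.prems assms by (auto intro: finite_subset)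
    obtain X where X: "X \<subseteq> W" "card X = min m (card W)"
      using obtain_subset_with_card_n[of "min m (card W)" W] by auto
    have "card (W - X) = card W - card X"
      using X fin by (intro card_Diff_subset) (auto intro: finite_subset)
    also have "\<dots> \<le> j * m" using Suc.prems X by simp
    finally have 1: "real (card (edge_pairs E U (W - X))) \<le> real j * B"
      using Suc by blast
    have 2: "real (card (edge_pairs E U X)) \<le> B"
      using X Suc.prems by (intro piece) auto
    have "edge_pairs E U W = edge_pairs E U (W - X) \<union> edge_pairs E U X"
      using X by (auto simp: edge_pairs_def)
    then have "card (edge_pairs E U W) \<le> card (edge_pairs E U (W - X)) + card (edge_pairs E U X)"
      by (simp add: card_Un_le)
    then show ?case using 1 2 by (simp add: algebra_simps)
  qed
  \<comment> \<open>Enough pieces to cover \<open>V\<close>, yet \<open>j * m \<le> 2 * n\<close>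
    because \<open>m \<le> n\<close>. Together with \<open>2 powr (1 / k) \<le> 2\<close> this
    yields \<open>320 = 40 * 4 * 2\<close>.\<close>
  define j where "j = Suc (n div m)"
  have "n \<le> j * m"
    using div_mult_mod_eq[of n m] mod_less_divisor[OF \<open>0 < m\<close>, of n]
    unfolding j_def mult_Suc by linarith
  then have "real (card (edge_pairs E U V)) \<le> real j * B"
    using U by (intro pieces) auto
  also have "\<dots> = 40 * real k * (real (2 * (j * m)) * real (2 * m) powr (1 / real k))"
    by (simp add: B_def)
  also have "\<dots> \<le> 40 * real k * (real (4 * n) * (2 * real m powr (1 / real k)))"
  proof (intro mult_left_mono mult_mono)
    have "j * m = m + n div m * m" by (simp add: j_def)
    also have "\<dots> \<le> n + n" using \<open>m \<le> n\<close> by (intro add_mono) simp_all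
    finally have "2 * (j * m) \<le> 4 * n" by linarith
    then show "real (2 * (j * m)) \<le> real (4 * n)" by (rule of_nat_mono)
    have "(2::real) powr (1 / real k) \<le> 2 powr 1"
      using \<open>0 < k\<close> by (intro powr_mono) auto
    then show "real (2 * m) powr (1 / real k) \<le> 2 * real m powr (1 / real k)"
      by (simp add: powr_mult mult_right_mono)
  qed auto
  finally show ?thesis by (simp add: algebra_simps)
qed

section \<open>Regularity and triangle removal\<close>

lemma sum_mono_classes:
  fixes g h :: "'w \<Rightarrow> real"
  assumes "finite \<Omega>"
    and "\<And>w0. w0 \<in> \<Omega> \<Longrightarrow> (\<Sum>w\<in>{w\<in>\<Omega>. \<kappa> w = \<kappa> w0}. g w) \<le> (\<Sum>w\<in>{w\<in>\<Omega>. \<kappa> w = \<kappa> w0}. h w)"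
  shows "sum g \<Omega> \<le> sum h \<Omega>"
proof -
  have "sum g \<Omega> = (\<Sum>y\<in>\<kappa> ` \<Omega>. \<Sum>w\<in>{w\<in>\<Omega>. \<kappa> w = y}. g w)"
    by (rule sum.image_gen[OF assms(1)])
  also have "\<dots> \<le> (\<Sum>y\<in>\<kappa> ` \<Omega>. \<Sum>w\<in>{w\<in>\<Omega>. \<kappa> w = y}. h w)"
  proof (rule sum_mono)
    fix y assume "y \<in> \<kappa> ` \<Omega>"
    then obtain w0 where "w0 \<in> \<Omega>" "y = \<kappa> w0" by blast
    then show "(\<Sum>w\<in>{w\<in>\<Omega>. \<kappa> w = y}. g w) \<le> (\<Sum>w\<in>{w\<in>\<Omega>. \<kappa> w = y}. h w)"
      using assms(2) by simp
  qed
  also have "\<dots> = sum h \<Omega>"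
    by (rule sum.image_gen[OF assms(1), symmetric])
  finally show ?thesis .
qed

text \<open>The conditional expectation of \<open>f\<close> given \<open>\<kappa>\<close>.
  Partitions are encoded as colourings, and a finer one is a colouring that determines the coarser
  one.\<close>

definition cond_avg :: "'w set \<Rightarrow> ('w \<Rightarrow> 'k) \<Rightarrow> ('w \<Rightarrow> real) \<Rightarrow> 'w \<Rightarrow> real" where
  "cond_avg \<Omega> \<kappa> f w = (\<Sum>v\<in>{v\<in>\<Omega>. \<kappa> v = \<kappa> w}. f v) / real (card {v\<in>\<Omega>. \<kappa> v = \<kappa> w})"

lemma sum_cond_avg_mult:
  assumes "finite \<Omega>"
    and h: "\<And>v w. v \<in> \<Omega> \<Longrightarrow> w \<in> \<Omega> \<Longrightarrow> \<kappa> v = \<kappa> w \<Longrightarrow> h v = h w"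
  shows "(\<Sum>w\<in>\<Omega>. cond_avg \<Omega> \<kappa> f w * h w) = (\<Sum>w\<in>\<Omega>. f w * h w)"
proof -
  have "(\<Sum>w\<in>{w\<in>\<Omega>. \<kappa> w = \<kappa> v}. cond_avg \<Omega> \<kappa> f w * h w) = (\<Sum>w\<in>{w\<in>\<Omega>. \<kappa> w = \<kappa> v}. f w * h w)"
    if "v \<in> \<Omega>" for v
  proof -
    let ?K = "{w\<in>\<Omega>. \<kappa> w = \<kappa> v}"
    have "card ?K \<noteq> 0" using assms(1) that by auto
    have "(\<Sum>w\<in>?K. cond_avg \<Omega> \<kappa> f w * h w) = (\<Sum>w\<in>?K. (sum f ?K / real (card ?K)) * h v)"
    proof (rule sum.cong[OF refl])
      fix w assume w: "w \<in> ?K"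
      then have "h w = h v" using h[of w v] that by simp
      with w show "cond_avg \<Omega> \<kappa> f w * h w = (sum f ?K / real (card ?K)) * h v"
        by (simp add: cond_avg_def)
    qed
    also have "\<dots> = sum f ?K * h v"
      using \<open>card ?K \<noteq> 0\<close> by simp
    also have "\<dots> = (\<Sum>w\<in>?K. f w * h v)" by (rule sum_distrib_right)
    also have "\<dots> = (\<Sum>w\<in>?K. f w * h w)"
    proof (rule sum.cong[OF refl])
      fix w assume "w \<in> ?K"
      then have "h v = h w" using h[of v w] that by simp
      then show "f w * h v = f w * h w" by simp
    qed
    finally show ?thesis .
  qed
  then show ?thesis
    using sum_mono_classes[OF assms(1), where \<kappa> = \<kappa> and g = "\<lambda>w. cond_avg \<Omega> \<kappa> f w * h w" and h = "\<lambda>w. f w * h w"]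
      sum_mono_classes[OF assms(1), where \<kappa> = \<kappa> and h = "\<lambda>w. cond_avg \<Omega> \<kappa> f w * h w" and g = "\<lambda>w. f w * h w"]
    by (simp add: antisym)
qed

lemma cond_avg_cong: "\<kappa> v = \<kappa> w \<Longrightarrow> cond_avg \<Omega> \<kappa> f v = cond_avg \<Omega> \<kappa> f w"
  by (simp add: cond_avg_def)

text \<open>Averaging is an orthogonal projection: the cross term and the square of the coarser
  average both equal the sum of \<open>f\<close> times the coarser average.\<close>

lemma cond_avg_pythagoras:
  assumes "finite \<Omega>"
    and refine: "\<And>v w. v \<in> \<Omega> \<Longrightarrow> w \<in> \<Omega> \<Longrightarrow> \<kappa>' v = \<kappa>' w \<Longrightarrow> \<kappa> v = \<kappa> w"
  shows "(\<Sum>w\<in>\<Omega>. (cond_avg \<Omega> \<kappa>' f w - cond_avg \<Omega> \<kappa> f w)\<^sup>2)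
    = (\<Sum>w\<in>\<Omega>. (cond_avg \<Omega> \<kappa>' f w)\<^sup>2) - (\<Sum>w\<in>\<Omega>. (cond_avg \<Omega> \<kappa> f w)\<^sup>2)"
proof -
  have 1: "(\<Sum>w\<in>\<Omega>. cond_avg \<Omega> \<kappa>' f w * cond_avg \<Omega> \<kappa> f w) = (\<Sum>w\<in>\<Omega>. f w * cond_avg \<Omega> \<kappa> f w)"
    by (rule sum_cond_avg_mult[OF assms(1)]) (intro cond_avg_cong refine)
  have 2: "(\<Sum>w\<in>\<Omega>. cond_avg \<Omega> \<kappa> f w * cond_avg \<Omega> \<kappa> f w) = (\<Sum>w\<in>\<Omega>. f w * cond_avg \<Omega> \<kappa> f w)"
    by (rule sum_cond_avg_mult[OF assms(1)]) (rule cond_avg_cong)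
  have "(\<Sum>w\<in>\<Omega>. (cond_avg \<Omega> \<kappa>' f w - cond_avg \<Omega> \<kappa> f w)\<^sup>2)
    = (\<Sum>w\<in>\<Omega>. (cond_avg \<Omega> \<kappa>' f w)\<^sup>2 + cond_avg \<Omega> \<kappa> f w * cond_avg \<Omega> \<kappa> f w
        - 2 * (cond_avg \<Omega> \<kappa>' f w * cond_avg \<Omega> \<kappa> f w))"
    by (intro sum.cong) (auto simp: power2_eq_square algebra_simps)
  also have "\<dots> = (\<Sum>w\<in>\<Omega>. (cond_avg \<Omega> \<kappa>' f w)\<^sup>2) + (\<Sum>w\<in>\<Omega>. cond_avg \<Omega> \<kappa> f w * cond_avg \<Omega> \<kappa> f w)
      - 2 * (\<Sum>w\<in>\<Omega>. cond_avg \<Omega> \<kappa>' f w * cond_avg \<Omega> \<kappa> f w)"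
    by (simp add: sum.distrib sum_subtractf sum_distrib_left)
  also have "\<dots> = (\<Sum>w\<in>\<Omega>. (cond_avg \<Omega> \<kappa>' f w)\<^sup>2) - (\<Sum>w\<in>\<Omega>. cond_avg \<Omega> \<kappa> f w * cond_avg \<Omega> \<kappa> f w)"
    using 1 2 by simp
  finally show ?thesis by (simp add: power2_eq_square)
qed

section \<open>Density, energy and irregular pairs\<close>

definition cell :: "'a set \<Rightarrow> ('a \<Rightarrow> 'k) \<Rightarrow> 'a \<Rightarrow> 'a set" where
  "cell V c x = {v\<in>V. c v = c x}"

definition density :: "'a set \<Rightarrow> ('a \<Rightarrow> 'a \<Rightarrow> bool) \<Rightarrow> ('a \<Rightarrow> 'k) \<Rightarrow> 'a \<times> 'a \<Rightarrow> real" where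
  "density V E c = cond_avg (V \<times> V) (map_prod c c) (\<lambda>(x, y). of_bool (E x y))"

text \<open>The index of the partition, multiplied by \<open>(card V)\<^sup>2\<close>. Summing over
  pairs of vertices weights each pair of cells by its size, so the cells may be of unequal
  size.\<close>

definition energy :: "'a set \<Rightarrow> ('a \<Rightarrow> 'a \<Rightarrow> bool) \<Rightarrow> ('a \<Rightarrow> 'k) \<Rightarrow> real" where
  "energy V E c = (\<Sum>w\<in>V \<times> V. (density V E c w)\<^sup>2)"

text \<open>Only the half of regularity that the removal argument uses: a dense pair that has a
  sparse pair of large subsets.\<close>

definition irregular :: "real \<Rightarrow> ('a \<Rightarrow> 'a \<Rightarrow> bool) \<Rightarrow> 'a set \<Rightarrow> 'a set \<Rightarrow> bool" where
  "irregular \<epsilon> E A B \<longleftrightarrow> 2 * \<epsilon> * (real (card A) * real (card B)) \<le> real (card (edge_pairs E A B)) \<and>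
     (\<exists>X Y. X \<subseteq> A \<and> Y \<subseteq> B \<and> \<epsilon> * real (card A) \<le> card X \<and> \<epsilon> * real (card B) \<le> card Y \<and>
        card (edge_pairs E X Y) < \<epsilon> * (real (card X) * real (card Y)))"

lemma irregularI:
  assumes "2 * \<epsilon> * (real (card A) * real (card B)) \<le> real (card (edge_pairs E A B))"
    and "X \<subseteq> A" "Y \<subseteq> B" "\<epsilon> * real (card A) \<le> card X" "\<epsilon> * real (card B) \<le> card Y"
    and "card (edge_pairs E X Y) < \<epsilon> * (real (card X) * real (card Y))"
  shows "irregular \<epsilon> E A B"
  using assms unfolding irregular_def by blast

lemma cell_times: "{w \<in> V \<times> V. map_prod c c w = map_prod c c (x, y)} = cell V c x \<times> cell V c y"
  by (auto simp: cell_def)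

lemma finite_cell [simp]: "finite V \<Longrightarrow> finite (cell V c x)"
  by (simp add: cell_def)

lemma cell_nonempty: "x \<in> V \<Longrightarrow> cell V c x \<noteq> {}"
  by (auto simp: cell_def)

lemma card_cell_pos: "finite V \<Longrightarrow> x \<in> V \<Longrightarrow> 0 < card (cell V c x)"
  by (simp add: card_gt_0_iff cell_nonempty)

lemma sum_of_bool_edges:
  assumes "finite A" "finite B"
  shows "(\<Sum>(x, y)\<in>A \<times> B. of_bool (E x y)) = real (card (edge_pairs E A B))"
proof -
  have "(\<Sum>(x, y)\<in>A \<times> B. of_bool (E x y) :: real) = real (card {w \<in> A \<times> B. case w of (x, y) \<Rightarrow> E x y})"
    using assms by (simp add: case_prod_unfold sum_of_bool_eq Int_def conj_commute)
  also have "{w \<in> A \<times> B. case w of (x, y) \<Rightarrow> E x y} = edge_pairs E A B"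
    by (auto simp: edge_pairs_def)
  finally show ?thesis .
qed

lemma density_eq:
  assumes "finite V" "(v, w) \<in> cell V c x \<times> cell V c y"
  shows "density V E c (v, w)
    = card (edge_pairs E (cell V c x) (cell V c y)) / (real (card (cell V c x)) * real (card (cell V c y)))"
proof -
  have "cell V c v = cell V c x" "cell V c w = cell V c y" using assms(2) by (auto simp: cell_def)
  then show ?thesis
    using assms(1) unfolding density_def cond_avg_def cell_times
    by (simp add: sum_of_bool_edges card_cartesian_product)
qed

lemma sum_density:
  assumes "finite V" "X \<subseteq> V" "Y \<subseteq> V"
    and "\<And>v w. v \<in> V \<Longrightarrow> w \<in> V \<Longrightarrow> c v = c w \<Longrightarrow> (v \<in> X \<longleftrightarrow> w \<in> X) \<and> (v \<in> Y \<longleftrightarrow> w \<in> Y)"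
  shows "(\<Sum>w\<in>X \<times> Y. density V E c w) = card (edge_pairs E X Y)"
proof -
  have restrict: "(\<Sum>w\<in>X \<times> Y. g w) = (\<Sum>w\<in>V \<times> V. g w * of_bool (w \<in> X \<times> Y))" for g :: "'a \<times> 'a \<Rightarrow> real"
    using assms(1-3) by (intro sum.mono_neutral_cong_left) auto
  have "(\<Sum>w\<in>X \<times> Y. density V E c w) = (\<Sum>w\<in>V \<times> V. density V E c w * of_bool (w \<in> X \<times> Y))"
    by (rule restrict)
  also have "\<dots> = (\<Sum>w\<in>V \<times> V. (case w of (x, y) \<Rightarrow> of_bool (E x y)) * of_bool (w \<in> X \<times> Y))"
    unfolding density_def
  proof (rule sum_cond_avg_mult)
    fix v w assume vw: "v \<in> V \<times> V" "w \<in> V \<times> V" and "map_prod c c v = map_prod c c w"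
    then have "c (fst v) = c (fst w)" "c (snd v) = c (snd w)"
      by (cases v; cases w; simp)+
    with vw have "v \<in> X \<times> Y \<longleftrightarrow> w \<in> X \<times> Y"
      using assms(4)[of "fst v" "fst w"] assms(4)[of "snd v" "snd w"] by (auto simp: mem_Times_iff)
    then show "of_bool (v \<in> X \<times> Y) = (of_bool (w \<in> X \<times> Y) :: real)" by simp
  qed (use assms(1) in auto)
  also have "\<dots> = (\<Sum>(x, y)\<in>X \<times> Y. of_bool (E x y))"
    by (rule restrict[symmetric])
  also have "\<dots> = card (edge_pairs E X Y)"
    using assms(1-3) by (intro sum_of_bool_edges) (auto intro: finite_subset)
  finally show ?thesis .
qed

text \<open>On \<open>X \<times> Y\<close> the density for \<open>c\<close> is a constant of at
  least \<open>2 * \<epsilon>\<close>, while the density for \<open>c'\<close> averages below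
  \<open>\<epsilon>\<close>. The mean square change there is at least
  \<open>\<epsilon>\<^sup>2\<close>, and the sizes of \<open>X\<close> and \<open>Y\<close>
  contribute another \<open>\<epsilon>\<^sup>2\<close>.\<close>

lemma energy_gain_on_irregular_pair:
  fixes \<epsilon> :: real
  assumes "finite V" "x \<in> V" "y \<in> V" "0 < \<epsilon>"
    and dense: "2 * \<epsilon> * (real (card (cell V c x)) * real (card (cell V c y))) \<le> card (edge_pairs E (cell V c x) (cell V c y))"
    and X: "X \<subseteq> cell V c x" "\<epsilon> * real (card (cell V c x)) \<le> card X"
    and Y: "Y \<subseteq> cell V c y" "\<epsilon> * real (card (cell V c y)) \<le> card Y"
    and sparse: "card (edge_pairs E X Y) < \<epsilon> * (real (card X) * real (card Y))"
    and measurable: "\<And>v w. v \<in> V \<Longrightarrow> w \<in> V \<Longrightarrow> c' v = c' w \<Longrightarrow> (v \<in> X \<longleftrightarrow> w \<in> X) \<and> (v \<in> Y \<longleftrightarrow> w \<in> Y)"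
  shows "\<epsilon> ^ 4 * (real (card (cell V c x)) * real (card (cell V c y)))
    \<le> (\<Sum>w\<in>cell V c x \<times> cell V c y. (density V E c' w - density V E c w)\<^sup>2)"
proof -
  let ?A = "cell V c x" and ?B = "cell V c y"
  define \<delta> where "\<delta> = card (edge_pairs E ?A ?B) / (real (card ?A) * real (card ?B))"
  have fin: "finite ?A" "finite ?B" "finite X" "finite Y"
    using assms(1) X(1) Y(1) by (auto intro: finite_subset)
  have "real (card ?A) * real (card ?B) > 0"
    using card_cell_pos[OF assms(1,2), of c] card_cell_pos[OF assms(1,3), of c] by simp
  then have "2 * \<epsilon> \<le> \<delta>"
    using dense by (simp add: \<delta>_def pos_le_divide_eq)
  have const: "density V E c w = \<delta>" if "w \<in> X \<times> Y" for w
    using that X(1) Y(1) density_eq[OF assms(1), of "fst w" "snd w" c x y] by (auto simp: \<delta>_def mem_Times_iff)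
  have sumX: "(\<Sum>w\<in>X \<times> Y. density V E c' w) = card (edge_pairs E X Y)"
  proof (rule sum_density[OF assms(1)])
    show "X \<subseteq> V" "Y \<subseteq> V" using X(1) Y(1) by (auto simp: cell_def)
  qed (rule measurable)
  have "\<epsilon> ^ 4 * (real (card ?A) * real (card ?B)) = \<epsilon>\<^sup>2 * ((\<epsilon> * real (card ?A)) * (\<epsilon> * real (card ?B)))"
    by (simp add: power2_eq_square power4_eq_xxxx)
  also have "\<dots> \<le> \<epsilon>\<^sup>2 * (real (card X) * real (card Y))"
    using X(2) Y(2) \<open>0 < \<epsilon>\<close> by (intro mult_left_mono mult_mono) auto
  also have "\<dots> \<le> 2 * \<epsilon> * (2 * \<epsilon> * (real (card X) * real (card Y)))
      - 2 * \<epsilon> * (\<epsilon> * (real (card X) * real (card Y))) - \<epsilon>\<^sup>2 * (real (card X) * real (card Y))"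
    by (simp add: power2_eq_square)
  also have "\<dots> \<le> 2 * \<epsilon> * (\<delta> * (real (card X) * real (card Y)))
      - 2 * \<epsilon> * real (card (edge_pairs E X Y)) - \<epsilon>\<^sup>2 * (real (card X) * real (card Y))"
    using sparse \<open>2 * \<epsilon> \<le> \<delta>\<close> \<open>0 < \<epsilon>\<close>
    by (intro diff_right_mono diff_mono mult_left_mono mult_right_mono) auto
  also have "\<dots> = (\<Sum>w\<in>X \<times> Y. 2 * \<epsilon> * \<delta> - 2 * \<epsilon> * density V E c' w - \<epsilon>\<^sup>2)"
    using sumX by (simp add: sum_subtractf card_cartesian_product flip: sum_distrib_left)
  also have "\<dots> \<le> (\<Sum>w\<in>X \<times> Y. (density V E c' w - density V E c w)\<^sup>2)"
  proof (rule sum_mono)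
    fix w assume "w \<in> X \<times> Y"
    \<comment> \<open>For the new density \<open>d\<close>, the inequality \<open>(d -
      \<delta>)\<^sup>2 \<ge> 2 * \<epsilon> * (\<delta> - d) - \<epsilon>\<^sup>2\<close> bounds
      the square by a linear term, in place of Cauchy-Schwarz.\<close>
    have "0 \<le> (density V E c' w - \<delta> + \<epsilon>)\<^sup>2" by simp
    then show "2 * \<epsilon> * \<delta> - 2 * \<epsilon> * density V E c' w - \<epsilon>\<^sup>2 \<le> (density V E c' w - density V E c w)\<^sup>2"
      unfolding const[OF \<open>w \<in> X \<times> Y\<close>] by (simp add: power2_eq_square algebra_simps)
  qed
  also have "\<dots> \<le> (\<Sum>w\<in>?A \<times> ?B. (density V E c' w - density V E c w)\<^sup>2)"
    using fin X(1) Y(1) by (intro sum_mono2) auto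
  finally show ?thesis .
qed

definition irregular_pairs :: "real \<Rightarrow> 'a set \<Rightarrow> ('a \<Rightarrow> 'a \<Rightarrow> bool) \<Rightarrow> ('a \<Rightarrow> 'k) \<Rightarrow> ('a \<times> 'a) set" where
  "irregular_pairs \<epsilon> V E c = {(x, y) \<in> V \<times> V. irregular \<epsilon> E (cell V c x) (cell V c y)}"

text \<open>One refinement splits all irregular pairs at once. By Pythagoras the gain in energy is
  the total squared change of density, to which the pairs of cells contribute separately.\<close>

lemma energy_increment:
  fixes c :: "'a \<Rightarrow> nat" and \<epsilon> :: real
  assumes "finite V" "0 < \<epsilon>"
  shows "\<exists>c' :: 'a \<Rightarrow> nat. card (c' ` V) \<le> card (c ` V) * 2 ^ card (c ` V) * 2 ^ card (c ` V) \<and>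
    energy V E c + \<epsilon> ^ 4 * card (irregular_pairs \<epsilon> V E c) \<le> energy V E c'"
proof -
  let ?C = "\<lambda>i. {v\<in>V. c v = i}"
  define wit where "wit i j X Y \<longleftrightarrow> X \<subseteq> ?C i \<and> Y \<subseteq> ?C j \<and> \<epsilon> * real (card (?C i)) \<le> card X \<and> \<epsilon> * real (card (?C j)) \<le> card Y \<and>
        card (edge_pairs E X Y) < \<epsilon> * (real (card X) * real (card Y))" for i j X Y
  \<comment> \<open>One witness for each pair of colours. Where there is none, \<open>SOME\<close>
    gives an arbitrary pair of sets, which can only split the cells further.\<close>
  define W where "W i j = (SOME W. wit i j (fst W) (snd W))" for i j
  \<comment> \<open>A vertex records its colour and its membership in the witnesses of all pairs in
    which its cell comes first or comes second; hence the two powers of 2.\<close>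
  define g where "g x = (c x, {j \<in> c ` V. x \<in> fst (W (c x) j)}, {j \<in> c ` V. x \<in> snd (W j (c x))})" for x
  have "finite (g ` V)" using assms(1) by simp
  \<comment> \<open>Coding the new colours as numbers keeps the type of colourings, so that the
    refinement can be iterated.\<close>
  then obtain \<phi> :: "_ \<Rightarrow> nat" where \<phi>: "inj_on \<phi> (g ` V)"
    using finite_imp_inj_to_nat_seg by blast
  define c' where "c' x = \<phi> (g x)" for x
  have c'_eq: "g v = g w" if "v \<in> V" "w \<in> V" "c' v = c' w" for v w
    using \<phi> that by (auto simp: c'_def dest: inj_onD)
  have "card (c' ` V) = card (g ` V)"
    unfolding c'_def using card_image[OF \<phi>] by (simp add: image_image)
  also have "\<dots> \<le> card (c ` V \<times> Pow (c ` V) \<times> Pow (c ` V))"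
    using assms(1) by (intro card_mono) (auto simp: g_def)
  also have "\<dots> = card (c ` V) * 2 ^ card (c ` V) * 2 ^ card (c ` V)"
    using assms(1) by (simp add: card_cartesian_product card_Pow)
  finally have size: "card (c' ` V) \<le> card (c ` V) * 2 ^ card (c ` V) * 2 ^ card (c ` V)" .

  let ?\<Omega> = "V \<times> V" and ?\<kappa> = "map_prod c c"
  have "(\<Sum>w\<in>?\<Omega>. \<epsilon> ^ 4 * of_bool (w \<in> irregular_pairs \<epsilon> V E c))
      \<le> (\<Sum>w\<in>?\<Omega>. (density V E c' w - density V E c w)\<^sup>2)"
  proof (rule sum_mono_classes[where \<kappa> = ?\<kappa>])
    fix w0 assume "w0 \<in> V \<times> V"
    then obtain x y where xy: "w0 = (x, y)" "x \<in> V" "y \<in> V" by auto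
    have same: "w \<in> irregular_pairs \<epsilon> V E c \<longleftrightarrow> (x, y) \<in> irregular_pairs \<epsilon> V E c"
      if w: "w \<in> cell V c x \<times> cell V c y" for w
    proof -
      obtain v1 v2 where "w = (v1, v2)" "v1 \<in> V" "v2 \<in> V" "c v1 = c x" "c v2 = c y"
        using w by (auto simp: cell_def)
      then show ?thesis using xy by (simp add: irregular_pairs_def cell_def)
    qed
    have "(\<Sum>w\<in>cell V c x \<times> cell V c y. \<epsilon> ^ 4 * of_bool (w \<in> irregular_pairs \<epsilon> V E c))
      \<le> (\<Sum>w\<in>cell V c x \<times> cell V c y. (density V E c' w - density V E c w)\<^sup>2)"
    proof (cases "(x, y) \<in> irregular_pairs \<epsilon> V E c")
      case False
      then have "(\<Sum>w\<in>cell V c x \<times> cell V c y. \<epsilon> ^ 4 * of_bool (w \<in> irregular_pairs \<epsilon> V E c)) = 0"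
        using same by (intro sum.neutral) auto
      also have "\<dots> \<le> (\<Sum>w\<in>cell V c x \<times> cell V c y. (density V E c' w - density V E c w)\<^sup>2)"
        by (intro sum_nonneg) simp
      finally show ?thesis .
    next
      case True
      then have irr: "irregular \<epsilon> E (cell V c x) (cell V c y)" by (simp add: irregular_pairs_def)
      then obtain X0 Y0 where "wit (c x) (c y) X0 Y0"
        unfolding irregular_def wit_def cell_def by blast
      then have "wit (c x) (c y) (fst (X0, Y0)) (snd (X0, Y0))" by simp
      then have "wit (c x) (c y) (fst (W (c x) (c y))) (snd (W (c x) (c y)))"
        unfolding W_def by (rule someI[where P = "\<lambda>W. wit (c x) (c y) (fst W) (snd W)"])
      then obtain X Y where XY: "X = fst (W (c x) (c y))" "Y = snd (W (c x) (c y))" "wit (c x) (c y) X Y" by blast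
      then have XY': "X \<subseteq> cell V c x" "Y \<subseteq> cell V c y" "\<epsilon> * real (card (cell V c x)) \<le> card X"
        "\<epsilon> * real (card (cell V c y)) \<le> card Y" "card (edge_pairs E X Y) < \<epsilon> * (real (card X) * real (card Y))"
        unfolding wit_def cell_def by blast+
      have meas: "(v \<in> X \<longrightarrow> w \<in> X) \<and> (v \<in> Y \<longrightarrow> w \<in> Y)" if "v \<in> V" "w \<in> V" "c' v = c' w" for v w
      proof -
        have g: "g v = g w" using c'_eq that by blast
        then have "c v = c w" by (simp add: g_def)
        have "w \<in> X" if "v \<in> X"
        proof -
          have "c v = c x" using XY'(1) that by (auto simp: cell_def)
          then have "c y \<in> {j \<in> c ` V. v \<in> fst (W (c v) j)}" using that XY(1) xy by simp
          also have "\<dots> = {j \<in> c ` V. w \<in> fst (W (c w) j)}" using g unfolding g_def prod.inject by (elim conjE)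
          finally show ?thesis using XY(1) \<open>c v = c x\<close> \<open>c v = c w\<close> by simp
        qed
        moreover have "w \<in> Y" if "v \<in> Y"
        proof -
          have "c v = c y" using XY'(2) that by (auto simp: cell_def)
          then have "c x \<in> {j \<in> c ` V. v \<in> snd (W j (c v))}" using that XY(2) xy by simp
          also have "\<dots> = {j \<in> c ` V. w \<in> snd (W j (c w))}" using g unfolding g_def prod.inject by (elim conjE)
          finally show ?thesis using XY(2) \<open>c v = c y\<close> \<open>c v = c w\<close> by simp
        qed
        ultimately show ?thesis by blast
      qed
      have "(\<Sum>w\<in>cell V c x \<times> cell V c y. \<epsilon> ^ 4 * of_bool (w \<in> irregular_pairs \<epsilon> V E c))
          = (\<Sum>w\<in>cell V c x \<times> cell V c y. \<epsilon> ^ 4)"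
        using same True by (intro sum.cong) auto
      also have "\<dots> = \<epsilon> ^ 4 * (real (card (cell V c x)) * real (card (cell V c y)))"
        by (simp add: card_cartesian_product)
      also have "\<dots> \<le> (\<Sum>w\<in>cell V c x \<times> cell V c y. (density V E c' w - density V E c w)\<^sup>2)"
      proof (rule energy_gain_on_irregular_pair[OF assms(1) xy(2,3) assms(2)])
        show "2 * \<epsilon> * (real (card (cell V c x)) * real (card (cell V c y))) \<le> card (edge_pairs E (cell V c x) (cell V c y))"
          using irr by (simp add: irregular_def)
        show "(v \<in> X \<longleftrightarrow> w \<in> X) \<and> (v \<in> Y \<longleftrightarrow> w \<in> Y)" if "v \<in> V" "w \<in> V" "c' v = c' w" for v w
          using meas[OF that] meas[OF that(2,1) that(3)[symmetric]] by blast
      qed (use XY' in auto)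
      finally show ?thesis .
    qed
    then show "(\<Sum>w\<in>{w \<in> V \<times> V. ?\<kappa> w = ?\<kappa> w0}. \<epsilon> ^ 4 * of_bool (w \<in> irregular_pairs \<epsilon> V E c))
      \<le> (\<Sum>w\<in>{w \<in> V \<times> V. ?\<kappa> w = ?\<kappa> w0}. (density V E c' w - density V E c w)\<^sup>2)"
      unfolding xy(1) cell_times .
  qed (use assms(1) in simp)
  also have "\<dots> = energy V E c' - energy V E c"
    unfolding energy_def density_def
  proof (rule cond_avg_pythagoras)
    fix v w assume "v \<in> V \<times> V" "w \<in> V \<times> V" "map_prod c' c' v = map_prod c' c' w"
    then have "g (fst v) = g (fst w)" "g (snd v) = g (snd w)"
      using c'_eq by (auto simp: mem_Times_iff map_prod_def case_prod_unfold)
    then show "map_prod c c v = map_prod c c w"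
      by (simp add: g_def map_prod_def case_prod_unfold)
  qed (use assms(1) in simp)
  also have "(\<Sum>w\<in>?\<Omega>. \<epsilon> ^ 4 * of_bool (w \<in> irregular_pairs \<epsilon> V E c)) = \<epsilon> ^ 4 * card (irregular_pairs \<epsilon> V E c)"
  proof -
    have "?\<Omega> \<inter> {w. w \<in> irregular_pairs \<epsilon> V E c} = irregular_pairs \<epsilon> V E c"
      by (auto simp: irregular_pairs_def)
    then show ?thesis using assms(1) by (simp add: sum_of_bool_eq flip: sum_distrib_left)
  qed
  finally show ?thesis using size by (auto intro!: exI[of _ c'])
qed

lemma energy_le:
  assumes "finite V"
  shows "energy V E c \<le> (real (card V))\<^sup>2"
proof -
  have "energy V E c \<le> (\<Sum>w\<in>V \<times> V. 1)"
    unfolding energy_def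
  proof (rule sum_mono)
    fix w assume "w \<in> V \<times> V"
    then obtain x y where xy: "w = (x, y)" "x \<in> V" "y \<in> V" by auto
    have "card (edge_pairs E (cell V c x) (cell V c y)) \<le> card (cell V c x \<times> cell V c y)"
      using assms by (intro card_mono edge_pairs_subset) auto
    then have "real (card (edge_pairs E (cell V c x) (cell V c y))) \<le> real (card (cell V c x)) * real (card (cell V c y))"
      by (simp add: card_cartesian_product flip: of_nat_mult)
    moreover have "density V E c w = card (edge_pairs E (cell V c x) (cell V c y))
        / (real (card (cell V c x)) * real (card (cell V c y)))"
      using xy assms by (simp add: density_eq[of V x y c x y] cell_def)
    moreover have "0 < real (card (cell V c x)) * real (card (cell V c y))"
      using card_cell_pos[OF assms xy(2), of c] card_cell_pos[OF assms xy(3), of c] by simp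
    ultimately have "0 \<le> density V E c w" "density V E c w \<le> 1"
      by simp_all
    then show "(density V E c w)\<^sup>2 \<le> 1" by (simp add: power_le_one)
  qed
  then show ?thesis by (simp add: card_cartesian_product power2_eq_square)
qed

text \<open>A colouring with more than \<open>\<epsilon> * (card V)\<^sup>2\<close> irregular pairs
  has a refinement with at least \<open>\<epsilon> ^ 5 * (card V)\<^sup>2\<close> more energy, and
  the energy never exceeds \<open>(card V)\<^sup>2\<close>. Hence the number of rounds, and with it
  \<open>M\<close>, depends on \<open>\<epsilon>\<close> alone.\<close>

lemma regular_colouring:
  fixes \<epsilon> :: real
  assumes "0 < \<epsilon>"
  shows "\<exists>M>0. \<forall>(V :: 'a set) E. finite V \<longrightarrow>
    (\<exists>c :: 'a \<Rightarrow> nat. card (c ` V) \<le> M \<and> card (irregular_pairs \<epsilon> V E c) \<le> \<epsilon> * (real (card V))\<^sup>2)"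
proof -
  have step: "\<exists>M>0. \<forall>(V :: 'a set) E. finite V \<longrightarrow>
    (\<exists>c :: 'a \<Rightarrow> nat. card (c ` V) \<le> M \<and>
      (card (irregular_pairs \<epsilon> V E c) \<le> \<epsilon> * (real (card V))\<^sup>2 \<or> s * \<epsilon> ^ 5 * (real (card V))\<^sup>2 \<le> energy V E c))" for s :: nat
  proof (induction s)
    case 0
    have "card ((\<lambda>_. 0 :: nat) ` V) \<le> 1" for V :: "'a set"
      by (simp add: image_constant_conv)
    moreover have "0 \<le> energy V E (\<lambda>_. 0 :: nat)" for V :: "'a set" and E
      by (auto simp: energy_def intro: sum_nonneg)
    ultimately show ?case by (auto intro!: exI[of _ 1] exI[of _ "\<lambda>_. 0 :: nat"])
  next
    case (Suc s)
    then obtain M where M: "0 < M" and IH: "\<And>(V :: 'a set) E. finite V \<Longrightarrow> \<exists>c :: 'a \<Rightarrow> nat. card (c ` V) \<le> M \<and>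
      (card (irregular_pairs \<epsilon> V E c) \<le> \<epsilon> * (real (card V))\<^sup>2 \<or> s * \<epsilon> ^ 5 * (real (card V))\<^sup>2 \<le> energy V E c)"
      by blast
    define M' where "M' = M * 2 ^ M * 2 ^ M"
    have "M \<le> M'" by (simp add: M'_def mult.assoc)
    have "\<exists>c :: 'a \<Rightarrow> nat. card (c ` V) \<le> M' \<and>
      (card (irregular_pairs \<epsilon> V E c) \<le> \<epsilon> * (real (card V))\<^sup>2 \<or> Suc s * \<epsilon> ^ 5 * (real (card V))\<^sup>2 \<le> energy V E c)"
      if V: "finite V" for V :: "'a set" and E
    proof -
      obtain c :: "'a \<Rightarrow> nat" where c: "card (c ` V) \<le> M"
        "card (irregular_pairs \<epsilon> V E c) \<le> \<epsilon> * (real (card V))\<^sup>2 \<or> s * \<epsilon> ^ 5 * (real (card V))\<^sup>2 \<le> energy V E c"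
        using IH[OF V] by blast
      show ?thesis
      proof (cases "card (irregular_pairs \<epsilon> V E c) \<le> \<epsilon> * (real (card V))\<^sup>2")
        case True
        then show ?thesis using c(1) \<open>M \<le> M'\<close> le_trans by blast
      next
        case False
        obtain c' :: "'a \<Rightarrow> nat" where c': "card (c' ` V) \<le> card (c ` V) * 2 ^ card (c ` V) * 2 ^ card (c ` V)"
          "energy V E c + \<epsilon> ^ 4 * card (irregular_pairs \<epsilon> V E c) \<le> energy V E c'"
          using energy_increment[OF V assms] by blast
        have "card (c ` V) * 2 ^ card (c ` V) * 2 ^ card (c ` V) \<le> M'"
          unfolding M'_def using c(1) by (intro mult_le_mono power_increasing) auto
        moreover have "Suc s * \<epsilon> ^ 5 * (real (card V))\<^sup>2 \<le> energy V E c'"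
        proof -
          have "\<epsilon> ^ 4 * (\<epsilon> * (real (card V))\<^sup>2) \<le> \<epsilon> ^ 4 * card (irregular_pairs \<epsilon> V E c)"
            using False assms by (intro mult_left_mono) auto
          moreover have "s * \<epsilon> ^ 5 * (real (card V))\<^sup>2 \<le> energy V E c" using c(2) False by blast
          moreover have "Suc s * \<epsilon> ^ 5 * (real (card V))\<^sup>2
              = s * \<epsilon> ^ 5 * (real (card V))\<^sup>2 + \<epsilon> ^ 4 * (\<epsilon> * (real (card V))\<^sup>2)"
            by (simp add: algebra_simps eval_nat_numeral)
          ultimately show ?thesis using c'(2) by linarith
        qed
        ultimately show ?thesis using c'(1) le_trans by blast
      qed
    qed
    moreover have "0 < M'" using M by (simp add: M'_def)
    ultimately show ?case by blast
  qed
  obtain s :: nat where s: "1 / \<epsilon> ^ 5 < s" using reals_Archimedean2 by blast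
  then have s1: "1 < s * \<epsilon> ^ 5" using assms by (simp add: pos_divide_less_eq)
  obtain M where M: "0 < M" "\<And>(V :: 'a set) E. finite V \<Longrightarrow> \<exists>c :: 'a \<Rightarrow> nat. card (c ` V) \<le> M \<and>
      (card (irregular_pairs \<epsilon> V E c) \<le> \<epsilon> * (real (card V))\<^sup>2 \<or> s * \<epsilon> ^ 5 * (real (card V))\<^sup>2 \<le> energy V E c)"
    using step by blast
  have "\<exists>c :: 'a \<Rightarrow> nat. card (c ` V) \<le> M \<and> card (irregular_pairs \<epsilon> V E c) \<le> \<epsilon> * (real (card V))\<^sup>2"
    if V: "finite V" for V :: "'a set" and E
  proof (cases "V = {}")
    case True
    then show ?thesis by (simp add: irregular_pairs_def)
  next
    case False
    then have "0 < (real (card V))\<^sup>2" using V by (simp add: card_gt_0_iff)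
    then have "\<not> s * \<epsilon> ^ 5 * (real (card V))\<^sup>2 \<le> energy V E c" for c :: "'a \<Rightarrow> nat"
      using energy_le[OF V, of E c] s1 mult_strict_right_mono[OF s1, of "(real (card V))\<^sup>2"] by linarith
    then show ?thesis using M(2)[OF V] by blast
  qed
  then show ?thesis using M(1) by blast
qed

text \<open>Instead of counting triangles, the removal argument exhibits one vertex whose link is dense.\<close>

lemma dense_link_of_regular_triple:
  fixes \<epsilon> :: real
  assumes "finite V" "0 < \<epsilon>" "\<epsilon> < 1 / 2" "A \<subseteq> V" "B \<subseteq> V" "C \<subseteq> V" "A \<noteq> {}" "B \<noteq> {}" "C \<noteq> {}"
    and dense: "2 * \<epsilon> * (real (card A) * real (card B)) \<le> card (edge_pairs E A B)"
      "2 * \<epsilon> * (real (card A) * real (card C)) \<le> card (edge_pairs E A C)"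
      "2 * \<epsilon> * (real (card B) * real (card C)) \<le> card (edge_pairs E B C)"
    and reg: "\<not> irregular \<epsilon> E A B" "\<not> irregular \<epsilon> E A C" "\<not> irregular \<epsilon> E B C"
  shows "\<exists>v\<in>A. \<epsilon> ^ 3 * (real (card B) * real (card C)) \<le> card (edge_pairs E {u\<in>V. E v u} {u\<in>V. E v u})"
proof -
  have fin: "finite A" "finite B" "finite C" using assms by (auto intro: finite_subset)
  \<comment> \<open>If many vertices of \<open>A\<close> had few neighbours in \<open>D\<close>,
    these vertices together with all of \<open>D\<close> would witness irregularity.\<close>
  have low: "card {v\<in>A. card {u\<in>D. E v u} < \<epsilon> * real (card D)} < \<epsilon> * real (card A)"
    if D: "finite D" "D \<noteq> {}" "2 * \<epsilon> * (real (card A) * real (card D)) \<le> card (edge_pairs E A D)" "\<not> irregular \<epsilon> E A D" for D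
  proof (rule ccontr)
    let ?L = "{v\<in>A. card {u\<in>D. E v u} < \<epsilon> * real (card D)}"
    assume "\<not> card ?L < \<epsilon> * real (card A)"
    then have L: "\<epsilon> * real (card A) \<le> card ?L" by simp
    have "0 < \<epsilon> * real (card A)"
      using \<open>A \<noteq> {}\<close> \<open>0 < \<epsilon>\<close> fin by (simp add: card_gt_0_iff)
    with L have "card ?L \<noteq> 0" by linarith
    then have "?L \<noteq> {}" by (metis card.empty)
    have "real (card (edge_pairs E ?L D)) = (\<Sum>v\<in>?L. real (card {u\<in>D. E v u}))"
      using fin D(1) by (simp add: card_edge_pairs)
    also have "\<dots> < (\<Sum>v\<in>?L. \<epsilon> * real (card D))"
      using \<open>?L \<noteq> {}\<close> fin by (intro sum_strict_mono) auto
    also have "\<dots> = \<epsilon> * (real (card ?L) * real (card D))" by simp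
    finally have "irregular \<epsilon> E A D"
      using D(3) L \<open>\<epsilon> < 1 / 2\<close> by (intro irregularI[of _ A D _ ?L D]) (auto simp: mult_le_cancel_right2)
    with D(4) show False ..
  qed
  let ?LB = "{v\<in>A. card {u\<in>B. E v u} < \<epsilon> * real (card B)}" and ?LC = "{v\<in>A. card {u\<in>C. E v u} < \<epsilon> * real (card C)}"
  have "real (card (?LB \<union> ?LC)) \<le> real (card ?LB) + real (card ?LC)"
    using card_Un_le[of ?LB ?LC] by linarith
  also have "\<dots> < 2 * \<epsilon> * real (card A)"
    using low[OF fin(2) \<open>B \<noteq> {}\<close> dense(1) reg(1)] low[OF fin(3) \<open>C \<noteq> {}\<close> dense(2) reg(2)] by simp
  also have "\<dots> \<le> card A" using \<open>\<epsilon> < 1 / 2\<close> by (simp add: mult_le_cancel_right2)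
  finally have "\<not> A \<subseteq> ?LB \<union> ?LC" using fin(1) card_mono[of "?LB \<union> ?LC" A] by auto
  then obtain v where "v \<in> A" "v \<notin> ?LB \<union> ?LC" by blast
  then have v: "v \<in> A" "\<epsilon> * real (card B) \<le> card {u\<in>B. E v u}" "\<epsilon> * real (card C) \<le> card {u\<in>C. E v u}"
    by simp_all
  \<comment> \<open>Both neighbourhoods are large enough for the regularity of \<open>B\<close> and
    \<open>C\<close> to force edges between them, and these edges lie in the link of
    \<open>v\<close>.\<close>
  let ?X = "{u\<in>B. E v u}" and ?Y = "{u\<in>C. E v u}"
  have "\<epsilon> ^ 3 * (real (card B) * real (card C)) = \<epsilon> * ((\<epsilon> * real (card B)) * (\<epsilon> * real (card C)))"
    by (simp add: power3_eq_cube)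
  also have "\<dots> \<le> \<epsilon> * (real (card ?X) * real (card ?Y))"
    using v \<open>0 < \<epsilon>\<close> by (intro mult_left_mono mult_mono) auto
  also have "\<dots> \<le> card (edge_pairs E ?X ?Y)"
  proof (rule ccontr)
    assume "\<not> ?thesis"
    then have "irregular \<epsilon> E B C"
      using dense(3) v by (intro irregularI[of _ B C _ ?X ?Y]) auto
    with reg(3) show False ..
  qed
  also have "\<dots> \<le> real (card (edge_pairs E {u\<in>V. E v u} {u\<in>V. E v u}))"
    using assms by (intro of_nat_mono card_edge_pairs_mono) auto
  finally show ?thesis using v(1) by blast
qed

section \<open>Triangle removal\<close>

definition hits_triangles :: "'a set \<Rightarrow> ('a \<Rightarrow> 'a \<Rightarrow> bool) \<Rightarrow> ('a \<Rightarrow> 'a \<Rightarrow> bool) \<Rightarrow> bool" where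
  "hits_triangles V E R \<longleftrightarrow> symp R \<and> (\<forall>x y. R x y \<longrightarrow> E x y) \<and>
     (\<forall>x\<in>V. \<forall>y\<in>V. \<forall>z\<in>V. E x y \<longrightarrow> E y z \<longrightarrow> E x z \<longrightarrow> R x y \<or> R y z \<or> R x z)"

text \<open>\<open>R\<close> collects the edges in irregular or sparse pairs of cells and those that
  touch a small cell. A triangle without an edge of \<open>R\<close> runs through three cells,
  possibly equal, that form dense regular pairs and have size proportional to
  \<open>card V\<close>.\<close>

lemma triangle_removal_or_dense_link:
  fixes \<epsilon> :: real
  assumes "0 < \<epsilon>"
  shows "\<exists>\<delta>>0. \<forall>(V :: 'a set) E. finite V \<longrightarrow> symp E \<longrightarrow>
    (\<exists>v\<in>V. \<delta> * (real (card V))\<^sup>2 \<le> card (edge_pairs E {u\<in>V. E v u} {u\<in>V. E v u})) \<or>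
    (\<exists>R. hits_triangles V E R \<and> card (edge_pairs R V V) \<le> \<epsilon> * (real (card V))\<^sup>2)"
proof -
  \<comment> \<open>Irregular pairs cost \<open>e\<close>, sparse pairs \<open>2 * e\<close>, small
    cells \<open>e\<close> at either end; making the relation symmetric doubles the total to
    \<open>10 * e\<close>. The bound \<open>1 / 4\<close> keeps \<open>e\<close> below the
    \<open>1 / 2\<close> required of a regular triple.\<close>
  define e where "e = min (\<epsilon> / 10) (1 / 4)"
  have e: "0 < e" "e < 1 / 2" "10 * e \<le> \<epsilon>" using assms by (auto simp: e_def)
  obtain M where M: "0 < M" and reg: "\<And>(V :: 'a set) E. finite V \<Longrightarrow>
    \<exists>c :: 'a \<Rightarrow> nat. card (c ` V) \<le> M \<and> card (irregular_pairs e V E c) \<le> e * (real (card V))\<^sup>2"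
    using regular_colouring[OF e(1)] by blast
  \<comment> \<open>A cell that is not small holds at least the share \<open>e / M\<close> of the
    vertices; \<open>e ^ 3\<close> comes from the regular triple.\<close>
  define \<delta> where "\<delta> = e ^ 3 * (e / M)\<^sup>2"
  have "0 < \<delta>" using e M by (simp add: \<delta>_def)
  moreover have "(\<exists>v\<in>V. \<delta> * (real (card V))\<^sup>2 \<le> card (edge_pairs E {u\<in>V. E v u} {u\<in>V. E v u})) \<or>
    (\<exists>R. hits_triangles V E R \<and> card (edge_pairs R V V) \<le> \<epsilon> * (real (card V))\<^sup>2)"
    if V: "finite V" and E: "symp E" for V :: "'a set" and E
  proof -
    obtain c :: "'a \<Rightarrow> nat" where c: "card (c ` V) \<le> M" "card (irregular_pairs e V E c) \<le> e * (real (card V))\<^sup>2"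
      using reg[OF V] by blast
    define n where "n = real (card V)"
    define Small where "Small = {x\<in>V. card (cell V c x) < e * n / M}"
    define Sparse where "Sparse = {(x, y) \<in> V \<times> V. E x y \<and>
      card (edge_pairs E (cell V c x) (cell V c y)) < 2 * e * (real (card (cell V c x)) * real (card (cell V c y)))}"
    define R0 where "R0 x y \<longleftrightarrow> E x y \<and> ((x, y) \<in> irregular_pairs e V E c \<or> (x, y) \<in> Sparse \<or>
      x \<in> Small \<or> y \<in> Small)" for x y
    define R where "R x y \<longleftrightarrow> R0 x y \<or> R0 y x" for x y
    have small: "card Small \<le> e * n"
    proof -
      have "real (card Small) = (\<Sum>x\<in>V. of_bool (x \<in> Small))"
        using V by (simp add: sum_of_bool_eq Small_def Int_def)
      also have "\<dots> = (\<Sum>i\<in>c ` V. \<Sum>x\<in>{x\<in>V. c x = i}. of_bool (x \<in> Small))"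
        by (rule sum.image_gen[OF V])
      also have "\<dots> \<le> (\<Sum>i\<in>c ` V. e * n / M)"
      proof (rule sum_mono)
        fix i assume "i \<in> c ` V"
        then obtain x where x: "x \<in> V" "i = c x" by blast
        have same: "y \<in> Small \<longleftrightarrow> x \<in> Small" if "y \<in> {y\<in>V. c y = i}" for y
          using that x by (simp add: Small_def cell_def)
        show "(\<Sum>y\<in>{y\<in>V. c y = i}. of_bool (y \<in> Small)) \<le> e * n / M"
        proof (cases "x \<in> Small")
          case True
          have "(\<Sum>y\<in>{y\<in>V. c y = i}. of_bool (y \<in> Small)) = (\<Sum>y\<in>{y\<in>V. c y = i}. 1 :: real)"
            using same True by (intro sum.cong) auto
          also have "\<dots> = card (cell V c x)" using x by (simp add: cell_def)
          finally show ?thesis using True by (simp add: Small_def)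
        next
          case False
          then have "(\<Sum>y\<in>{y\<in>V. c y = i}. of_bool (y \<in> Small)) = (0 :: real)"
            using same by (intro sum.neutral) auto
          also have "0 \<le> e * n / M" using e by (simp add: n_def)
          finally show ?thesis .
        qed
      qed
      also have "\<dots> = card (c ` V) * (e * n / M)" by simp
      also have "\<dots> \<le> M * (e * n / M)"
        using c(1) e by (intro mult_right_mono) (auto simp: n_def)
      also have "\<dots> = e * n" using M by simp
      finally show ?thesis .
    qed
    have sparse: "card Sparse \<le> 2 * e * n\<^sup>2"
    proof -
      have "real (card Sparse) = (\<Sum>w\<in>V \<times> V. of_bool (w \<in> Sparse))"
      proof -
        have "(V \<times> V) \<inter> {w. w \<in> Sparse} = Sparse" by (auto simp: Sparse_def)
        then show ?thesis using V by (simp add: sum_of_bool_eq)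
      qed
      also have "\<dots> \<le> (\<Sum>w\<in>V \<times> V. 2 * e)"
      proof (rule sum_mono_classes[where \<kappa> = "map_prod c c"])
        fix w0 assume "w0 \<in> V \<times> V"
        then obtain x y where xy: "w0 = (x, y)" "x \<in> V" "y \<in> V" by auto
        let ?A = "cell V c x" and ?B = "cell V c y"
        have same: "(v1, v2) \<in> Sparse \<longleftrightarrow> E v1 v2 \<and> card (edge_pairs E ?A ?B) < 2 * e * (real (card ?A) * real (card ?B))"
          if "v1 \<in> ?A" "v2 \<in> ?B" for v1 v2
          using that by (simp add: Sparse_def cell_def)
        have "(\<Sum>w\<in>?A \<times> ?B. of_bool (w \<in> Sparse)) \<le> (\<Sum>w\<in>?A \<times> ?B. 2 * e)"
        proof (cases "card (edge_pairs E ?A ?B) < 2 * e * (real (card ?A) * real (card ?B))")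
          case True
          have "(\<Sum>w\<in>?A \<times> ?B. of_bool (w \<in> Sparse)) = (\<Sum>(v1, v2)\<in>?A \<times> ?B. of_bool (E v1 v2) :: real)"
            using same True by (intro sum.cong) auto
          also have "\<dots> = card (edge_pairs E ?A ?B)" using V by (intro sum_of_bool_edges) auto
          also have "\<dots> \<le> 2 * e * (real (card ?A) * real (card ?B))" using True by simp
          finally show ?thesis by (simp add: card_cartesian_product mult_ac)
        next
          case False
          then have "(\<Sum>w\<in>?A \<times> ?B. of_bool (w \<in> Sparse)) = (0 :: real)"
            using same by (intro sum.neutral) auto
          also have "0 \<le> (\<Sum>w\<in>?A \<times> ?B. 2 * e)" using e by (intro sum_nonneg) auto
          finally show ?thesis .
        qed
        then show "(\<Sum>w\<in>{w \<in> V \<times> V. map_prod c c w = map_prod c c w0}. of_bool (w \<in> Sparse))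
          \<le> (\<Sum>w\<in>{w \<in> V \<times> V. map_prod c c w = map_prod c c w0}. 2 * e)"
          unfolding xy(1) cell_times .
      qed (use V in simp)
      also have "\<dots> = 2 * e * n\<^sup>2" by (simp add: card_cartesian_product n_def power2_eq_square)
      finally show ?thesis .
    qed
    have "edge_pairs R0 V V \<subseteq> irregular_pairs e V E c \<union> Sparse \<union> Small \<times> V \<union> V \<times> Small"
      by (auto simp: edge_pairs_def R0_def)
    moreover have finS: "finite (irregular_pairs e V E c)" "finite Sparse" "finite Small"
      using V by (auto simp: irregular_pairs_def Sparse_def Small_def intro: finite_subset[of _ "V \<times> V"])
    ultimately have "card (edge_pairs R0 V V) \<le> card (irregular_pairs e V E c \<union> Sparse \<union> Small \<times> V \<union> V \<times> Small)"
      using V by (intro card_mono) auto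
    also have "\<dots> \<le> card (irregular_pairs e V E c) + card Sparse + card (Small \<times> V) + card (V \<times> Small)"
      by (meson add_mono card_Un_le le_trans order_refl)
    also have "\<dots> = card (irregular_pairs e V E c) + card Sparse + card Small * card V + card Small * card V"
      by (simp add: card_cartesian_product)
    finally have "real (card (edge_pairs R0 V V))
        \<le> real (card (irregular_pairs e V E c)) + card Sparse + card Small * n + card Small * n"
      by (simp add: n_def flip: of_nat_mult of_nat_add)
    also have "\<dots> \<le> e * n\<^sup>2 + 2 * e * n\<^sup>2 + (e * n) * n + (e * n) * n"
      using c(2) sparse small by (intro add_mono mult_right_mono) (auto simp: n_def)
    also have "\<dots> = 5 * e * n\<^sup>2" by (simp add: power2_eq_square)
    finally have R0: "real (card (edge_pairs R0 V V)) \<le> 5 * e * n\<^sup>2" .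
    have symR: "symp R" by (auto simp: R_def symp_def)
    have "edge_pairs R V V = edge_pairs R0 V V \<union> prod.swap ` edge_pairs R0 V V"
      by (auto simp: edge_pairs_def R_def)
    then have "card (edge_pairs R V V) \<le> card (edge_pairs R0 V V) + card (prod.swap ` edge_pairs R0 V V)"
      by (simp add: card_Un_le)
    also have "\<dots> = 2 * card (edge_pairs R0 V V)" by (simp add: card_image)
    finally have "real (card (edge_pairs R V V)) \<le> 2 * real (card (edge_pairs R0 V V))" by linarith
    also have "\<dots> \<le> 10 * e * n\<^sup>2" using R0 by simp
    also have "\<dots> \<le> \<epsilon> * n\<^sup>2" using e(3) by (intro mult_right_mono) auto
    finally have cardR: "real (card (edge_pairs R V V)) \<le> \<epsilon> * (real (card V))\<^sup>2" by (simp add: n_def)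
    show ?thesis
    proof (cases "\<forall>x\<in>V. \<forall>y\<in>V. \<forall>z\<in>V. E x y \<longrightarrow> E y z \<longrightarrow> E x z \<longrightarrow> R x y \<or> R y z \<or> R x z")
      case True
      moreover have "\<forall>x y. R x y \<longrightarrow> E x y" using E by (auto simp: R_def R0_def dest: sympD)
      ultimately have "hits_triangles V E R" using symR by (simp add: hits_triangles_def)
      then show ?thesis using cardR by blast
    next
      case False
      then obtain x y z where xyz: "x \<in> V" "y \<in> V" "z \<in> V" "E x y" "E y z" "E x z"
        "\<not> R0 x y" "\<not> R0 y z" "\<not> R0 x z"
        unfolding R_def by blast
      let ?A = "cell V c x" and ?B = "cell V c y" and ?C = "cell V c z"
      have "\<exists>v\<in>?A. e ^ 3 * (real (card ?B) * real (card ?C)) \<le> card (edge_pairs E {u\<in>V. E v u} {u\<in>V. E v u})"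
      proof (rule dense_link_of_regular_triple[OF V e(1,2)])
        show "?A \<subseteq> V" "?B \<subseteq> V" "?C \<subseteq> V" by (auto simp: cell_def)
      qed (use xyz in \<open>auto simp: R0_def irregular_pairs_def Sparse_def cell_nonempty\<close>)
      then obtain v where v: "v \<in> V" "e ^ 3 * (real (card ?B) * real (card ?C)) \<le> card (edge_pairs E {u\<in>V. E v u} {u\<in>V. E v u})"
        by (auto simp: cell_def)
      have BC: "e * n / M \<le> card ?B" "e * n / M \<le> card ?C"
        using xyz by (auto simp: R0_def Small_def)
      have "\<delta> * n\<^sup>2 = e ^ 3 * ((e * n / M) * (e * n / M))"
        by (simp add: \<delta>_def power2_eq_square)
      also have "\<dots> \<le> e ^ 3 * (real (card ?B) * real (card ?C))"
        using BC e by (intro mult_left_mono mult_mono) (auto simp: n_def)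
      finally have "\<delta> * (real (card V))\<^sup>2 \<le> card (edge_pairs E {u\<in>V. E v u} {u\<in>V. E v u})"
        using v(2) by (simp add: n_def)
      then show ?thesis using v(1) by blast
    qed
  qed
  ultimately show ?thesis by blast
qed

section \<open>Triangles in graphs with even-cycle-free links\<close>

definition triangles :: "'a set \<Rightarrow> ('a \<Rightarrow> 'a \<Rightarrow> bool) \<Rightarrow> ('a \<times> 'a \<times> 'a) set" where
  "triangles V E = {(x, y, z). x \<in> V \<and> y \<in> V \<and> z \<in> V \<and> E x y \<and> E y z \<and> E x z}"

lemma finite_triangles: "finite V \<Longrightarrow> finite (triangles V E)"
  by (rule finite_subset[of _ "V \<times> V \<times> V"]) (auto simp: triangles_def)

text \<open>The summand at \<open>x\<close> counts the edges of the link of \<open>x\<close> that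
  start in its neighbourhood along \<open>R\<close>. Permuting a triangle moves an edge of
  \<open>R\<close> to the first two places, and the three possible positions of that edge give the
  factor 3.\<close>

lemma card_triangles_le_hit:
  assumes "finite V" "symp E" "hits_triangles V E R"
  shows "card (triangles V E) \<le> 3 * (\<Sum>x\<in>V. card (edge_pairs E {y\<in>V. R x y} {z\<in>V. E x z}))"
proof -
  define S where "S = (SIGMA x:V. edge_pairs E {y\<in>V. R x y} {z\<in>V. E x z})"
  have finS: "finite S" using assms(1) by (auto simp: S_def)
  let ?f = "\<lambda>(a, b, c). (c, a, b)" and ?g = "\<lambda>(a, b, c). (a, c, b)"
  have sub: "triangles V E \<subseteq> S \<union> ?f ` S \<union> ?g ` S"
  proof
    fix p assume "p \<in> triangles V E"
    then obtain x y z where p: "p = (x, y, z)" "x \<in> V" "y \<in> V" "z \<in> V" "E x y" "E y z" "E x z"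
      by (auto simp: triangles_def)
    have E': "E y x" "E z y" "E z x" using p assms(2) by (auto dest: sympD)
    consider "R x y" | "R y z" | "R x z" using assms(3) p unfolding hits_triangles_def by blast
    then show "p \<in> S \<union> ?f ` S \<union> ?g ` S"
    proof cases
      case 1
      then have "p \<in> S" using p by (simp add: S_def edge_pairs_def)
      then show ?thesis by blast
    next
      case 2
      then have "(y, z, x) \<in> S" using p E' by (simp add: S_def edge_pairs_def)
      then have "?f (y, z, x) \<in> ?f ` S" by (rule imageI)
      then show ?thesis using p(1) by simp
    next
      case 3
      then have "(x, z, y) \<in> S" using p E' by (simp add: S_def edge_pairs_def)
      then have "?g (x, z, y) \<in> ?g ` S" by (rule imageI)
      then show ?thesis using p(1) by simp
    qed
  qed
  have "card (triangles V E) \<le> card (S \<union> ?f ` S \<union> ?g ` S)"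
    using finS by (intro card_mono sub) auto
  also have "\<dots> \<le> card S + card (?f ` S) + card (?g ` S)"
    by (meson add_mono card_Un_le le_trans order_refl)
  also have "\<dots> \<le> card S + card S + card S"
    using finS by (intro add_mono card_image_le order_refl)
  also have "card S = (\<Sum>x\<in>V. card (edge_pairs E {y\<in>V. R x y} {z\<in>V. E x z}))"
    unfolding S_def using assms(1) by (intro card_SigmaI) auto
  finally show ?thesis by simp
qed

text \<open>The bound on \<open>R\<close> has \<open>\<eta>\<^sup>2\<close> so that, by Markov's
  inequality, at most \<open>\<eta> * n\<close> vertices have more than \<open>\<eta> * n\<close>
  neighbours along \<open>R\<close>. These exceptional vertices are charged with their whole links,
  which gives the term \<open>40 * \<eta>\<close>; the other term comes from the remaining
  vertices.\<close>

lemma few_triangles_of_even_cycle_free_links: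
  fixes V :: "'a set"
  assumes "finite V" "symp E" "irreflp E" "0 < k" "card V = n"
    and links: "\<And>v. v \<in> V \<Longrightarrow> \<not> has_cycle {u\<in>V. E v u} E (2 * k)"
    and R: "hits_triangles V E R" "card (edge_pairs R V V) \<le> \<eta>\<^sup>2 * (real n)\<^sup>2"
    and \<eta>: "0 < \<eta>" "\<eta> \<le> 1" "1 \<le> \<eta> * n"
  shows "real (card (triangles V E))
    \<le> 3 * real k * (320 * (2 * \<eta>) powr (1 / real k) + 40 * \<eta>) * ((real n)\<^sup>2 * real n powr (1 / real k))"
proof -
  define t where "t = real n powr (1 / real k)"
  define Nb where "Nb x = {y\<in>V. R x y}" for x
  define P where "P x = edge_pairs E (Nb x) {z\<in>V. E x z}" for x
  define Bad where "Bad = {x\<in>V. \<eta> * n < card (Nb x)}"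
  \<comment> \<open>Rounding up at most doubles \<open>\<eta> * n\<close>, since
    \<open>1 \<le> \<eta> * n\<close>. This is the origin of \<open>2 * \<eta>\<close> in the
    bound.\<close>
  define m where "m = nat \<lceil>\<eta> * n\<rceil>"
  have n0: "0 < n" using \<eta> by (cases n) auto
  have t0: "0 \<le> t" by (simp add: t_def)
  have m: "0 < m" "\<eta> * n \<le> m" "m \<le> 2 * \<eta> * n" "m \<le> n"
  proof -
    show "\<eta> * n \<le> m" unfolding m_def by (rule real_nat_ceiling_ge)
    then show "0 < m" using \<eta> by linarith
    have "real m < \<eta> * n + 1" using \<eta> by (simp add: m_def) linarith
    then show "m \<le> 2 * \<eta> * n" using \<eta>(3) by simp
    have "\<eta> * n \<le> n" using \<eta> by (simp add: mult_left_le_one_le)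
    then show "m \<le> n" unfolding m_def by (simp add: ceiling_le_iff nat_le_iff)
  qed
  have Nb: "Nb x \<subseteq> {z\<in>V. E x z}" for x using R(1) by (auto simp: Nb_def hits_triangles_def)
  have finN: "finite {z\<in>V. E x z}" for x using assms(1) by simp
  have cardN: "card {z\<in>V. E x z} \<le> n" for x
    using card_mono[OF assms(1), of "{z\<in>V. E x z}"] assms(5) by auto
  have bad: "real (card (P x)) \<le> 40 * real k * (real n * t)" if "x \<in> V" for x
  proof -
    have "card (P x) \<le> card (edge_pairs E {z\<in>V. E x z} {z\<in>V. E x z})"
      unfolding P_def by (rule card_edge_pairs_mono[OF finN finN Nb order_refl])
    also have "real \<dots> \<le> 40 * real k * (real n * t)"
      unfolding t_def using even_cycle_free_edge_bound_powr[OF finN assms(2,3) links[OF that] assms(4) cardN] .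
    finally show ?thesis by simp
  qed
  have good: "real (card (P x)) \<le> 320 * real k * (real n * ((2 * \<eta>) powr (1 / real k) * t))"
    if "x \<in> V - Bad" for x
  proof -
    have x: "x \<in> V" "card (Nb x) \<le> \<eta> * n" using that by (auto simp: Bad_def)
    then have "card (Nb x) \<le> m" using m(2) by linarith
    then have "real (card (P x)) \<le> 320 * real k * (real n * real m powr (1 / real k))"
      unfolding P_def
      using even_cycle_free_edges_touching[OF finN assms(2,3) links[OF x(1)] assms(4) Nb _ m(1,4) cardN] by blast
    also have "\<dots> \<le> 320 * real k * (real n * (2 * \<eta> * n) powr (1 / real k))"
      using m(3) by (intro mult_left_mono powr_mono2) auto
    also have "(2 * \<eta> * n) powr (1 / real k) = (2 * \<eta>) powr (1 / real k) * t"
      using \<eta> by (simp add: powr_mult t_def)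
    finally show ?thesis .
  qed
  have few_bad: "card Bad \<le> \<eta> * n"
  proof -
    have "card Bad * (\<eta> * n) = (\<Sum>x\<in>Bad. \<eta> * n)" by simp
    also have "\<dots> \<le> (\<Sum>x\<in>Bad. real (card (Nb x)))"
      by (intro sum_mono) (auto simp: Bad_def)
    also have "\<dots> \<le> (\<Sum>x\<in>V. real (card (Nb x)))"
      using assms(1) by (intro sum_mono2) (auto simp: Bad_def)
    also have "\<dots> = card (edge_pairs R V V)"
      using assms(1) by (simp add: card_edge_pairs Nb_def)
    also have "\<dots> \<le> (\<eta> * n) * (\<eta> * n)"
      using R(2) by (simp add: power2_eq_square mult_ac)
    finally show ?thesis using \<eta>(3) by (simp add: mult_le_cancel_right)
  qed
  have "(\<Sum>x\<in>V. real (card (P x))) = (\<Sum>x\<in>V - Bad. real (card (P x))) + (\<Sum>x\<in>Bad. real (card (P x)))"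
    using assms(1) by (intro sum.subset_diff) (auto simp: Bad_def)
  also have "\<dots> \<le> (\<Sum>x\<in>V - Bad. 320 * real k * (real n * ((2 * \<eta>) powr (1 / real k) * t)))
      + (\<Sum>x\<in>Bad. 40 * real k * (real n * t))"
    using good bad by (intro add_mono sum_mono) (auto simp: Bad_def)
  also have "\<dots> = real (card (V - Bad)) * (320 * real k * (real n * ((2 * \<eta>) powr (1 / real k) * t)))
      + real (card Bad) * (40 * real k * (real n * t))" by simp
  also have "\<dots> \<le> real n * (320 * real k * (real n * ((2 * \<eta>) powr (1 / real k) * t)))
      + (\<eta> * n) * (40 * real k * (real n * t))"
  proof (intro add_mono mult_right_mono)
    show "real (card (V - Bad)) \<le> real n" using assms(1,5) card_mono[of V "V - Bad"] by auto
    show "real (card Bad) \<le> \<eta> * n" by (rule few_bad)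
  qed (use t0 in auto)
  also have "\<dots> = real k * (320 * (2 * \<eta>) powr (1 / real k) + 40 * \<eta>) * ((real n)\<^sup>2 * t)"
    by (simp add: algebra_simps power2_eq_square)
  finally have sum: "(\<Sum>x\<in>V. real (card (P x))) \<le> real k * (320 * (2 * \<eta>) powr (1 / real k) + 40 * \<eta>) * ((real n)\<^sup>2 * t)" .
  have "card (triangles V E) \<le> 3 * (\<Sum>x\<in>V. card (P x))"
    unfolding P_def Nb_def by (rule card_triangles_le_hit[OF assms(1,2) R(1)])
  then have "real (card (triangles V E)) \<le> real (3 * (\<Sum>x\<in>V. card (P x)))"
    by (rule of_nat_mono)
  then have "real (card (triangles V E)) \<le> 3 * (\<Sum>x\<in>V. real (card (P x)))"
    by simp
  then show ?thesis using sum unfolding t_def by linarith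
qed

lemma even_cycle_free_links_imp_few_triangles:
  assumes "2 \<le> k" "0 < c"
  shows "\<exists>N. \<forall>(V :: 'a set) E. finite V \<longrightarrow> symp E \<longrightarrow> irreflp E \<longrightarrow> N \<le> card V \<longrightarrow>
    (\<forall>v\<in>V. \<not> has_cycle {u\<in>V. E v u} E (2 * k)) \<longrightarrow>
    real (card (triangles V E)) \<le> c * ((real (card V))\<^sup>2 * real (card V) powr (1 / real k))"
proof -
  \<comment> \<open>\<open>1080 = 3 * (320 + 40)\<close>. The choice of \<open>\<eta>\<close> below
    makes the \<open>k\<close>-th root of \<open>2 * \<eta>\<close> equal to \<open>s\<close>, and
    \<open>s \<le> 1\<close> ensures \<open>\<eta> \<le> s\<close>, so both terms are controlled by
    \<open>s\<close>.\<close>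
  define s where "s = min 1 (c / (1080 * real k))"
  have s: "0 < s" "s \<le> 1" "1080 * real k * s \<le> c"
  proof -
    show "0 < s" "s \<le> 1" using assms by (auto simp: s_def)
    have "1080 * real k * s \<le> 1080 * real k * (c / (1080 * real k))"
      by (intro mult_left_mono) (auto simp: s_def)
    then show "1080 * real k * s \<le> c" using assms by simp
  qed
  define \<eta> where "\<eta> = s ^ k / 2"
  have "s ^ k \<le> s ^ 1" using s assms by (intro power_decreasing) auto
  then have \<eta>: "0 < \<eta>" "\<eta> \<le> s" "\<eta> \<le> 1" using s by (auto simp: \<eta>_def)
  have root: "(2 * \<eta>) powr (1 / real k) = s"
    using s assms by (simp add: \<eta>_def powr_powr flip: powr_realpow)
  obtain \<delta> where \<delta>: "0 < \<delta>" and removal: "\<And>(V :: 'a set) E. finite V \<Longrightarrow> symp E \<Longrightarrow>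
    (\<exists>v\<in>V. \<delta> * (real (card V))\<^sup>2 \<le> card (edge_pairs E {u\<in>V. E v u} {u\<in>V. E v u})) \<or>
    (\<exists>R. hits_triangles V E R \<and> card (edge_pairs R V V) \<le> \<eta>\<^sup>2 * (real (card V))\<^sup>2)"
    using triangle_removal_or_dense_link[OF zero_less_power[OF \<eta>(1)], of 2, where ?'a = 'a] by blast
  \<comment> \<open>The first bound gives \<open>1 \<le> \<eta> * n\<close>. The second gives
    \<open>40 * k < \<delta> * sqrt n\<close>, so that a link, with at most
    \<open>40 * k * n * sqrt n\<close> ordered pairs, cannot be dense.\<close>
  obtain N :: nat where N: "max (1 / \<eta>) ((40 * real k / \<delta>)\<^sup>2) < N"
    using reals_Archimedean2 by blast
  have "real (card (triangles V E)) \<le> c * ((real (card V))\<^sup>2 * real (card V) powr (1 / real k))"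
    if V: "finite V" and E: "symp E" "irreflp E" and large: "N \<le> card V"
      and links: "\<forall>v\<in>V. \<not> has_cycle {u\<in>V. E v u} E (2 * k)" for V :: "'a set" and E
  proof -
    define n where "n = card V"
    have nN: "1 / \<eta> < n" "(40 * real k / \<delta>)\<^sup>2 < n"
      using N large by (auto simp: n_def)
    then have \<eta>n: "1 \<le> \<eta> * n" using \<eta>(1) by (simp add: pos_divide_less_eq mult.commute)
    have n1: "1 \<le> n" using \<eta>n \<eta>(1) by (cases n) auto
    have no_dense: "\<not> \<delta> * (real n)\<^sup>2 \<le> card (edge_pairs E {u\<in>V. E v u} {u\<in>V. E v u})" if v: "v \<in> V" for v
    proof -
      have "card (edge_pairs E {u\<in>V. E v u} {u\<in>V. E v u}) \<le> 40 * real k * (real n * real n powr (1 / real k))"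
      proof (rule even_cycle_free_edge_bound_powr)
        show "card {u\<in>V. E v u} \<le> n" unfolding n_def using V by (intro card_mono) auto
      qed (use V E links v assms in auto)
      also have "\<dots> \<le> 40 * real k * (real n * sqrt n)"
      proof -
        have "real n powr (1 / real k) \<le> real n powr (1 / 2)"
          using n1 assms by (intro powr_mono) (auto simp: field_simps)
        then show ?thesis using n1 by (intro mult_left_mono) (auto simp: powr_half_sqrt)
      qed
      also have "\<dots> < \<delta> * (real n)\<^sup>2"
      proof -
        have "40 * real k / \<delta> < sqrt n" using nN(2) by (rule real_less_rsqrt)
        then have "40 * real k < \<delta> * sqrt n" using \<delta> by (simp add: pos_divide_less_eq mult.commute)
        then have "40 * real k * (real n * sqrt n) < \<delta> * sqrt n * (real n * sqrt n)"
          using n1 by (intro mult_strict_right_mono) auto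
        also have "\<dots> = \<delta> * real n * (sqrt n * sqrt n)" by (simp only: mult_ac)
        also have "\<dots> = \<delta> * (real n)\<^sup>2" by (simp add: power2_eq_square)
        finally show ?thesis .
      qed
      finally show ?thesis by simp
    qed
    then obtain R where R: "hits_triangles V E R" "card (edge_pairs R V V) \<le> \<eta>\<^sup>2 * (real n)\<^sup>2"
      using removal[OF V E(1)] unfolding n_def by blast
    have "real (card (triangles V E))
      \<le> 3 * real k * (320 * (2 * \<eta>) powr (1 / real k) + 40 * \<eta>) * ((real n)\<^sup>2 * real n powr (1 / real k))"
    proof (rule few_triangles_of_even_cycle_free_links[OF V E _ n_def[symmetric] _ R \<eta>(1,3) \<eta>n])
      show "0 < k" using assms by simp
    qed (use links in blast)
    also have "\<dots> \<le> c * ((real n)\<^sup>2 * real n powr (1 / real k))"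
    proof (rule mult_right_mono)
      have "3 * real k * (320 * (2 * \<eta>) powr (1 / real k) + 40 * \<eta>) \<le> 3 * real k * (320 * s + 40 * s)"
        unfolding root using \<eta>(2) by (intro mult_left_mono) auto
      also have "\<dots> \<le> c" using s(3) by simp
      finally show "3 * real k * (320 * (2 * \<eta>) powr (1 / real k) + 40 * \<eta>) \<le> c" .
    qed auto
    finally show ?thesis by (simp add: n_def)
  qed
  then show ?thesis by blast
qed

section \<open>Return to copies of graphs\<close>

lemma edges_complete_graph_3: "edges (complete_graph 3) = {{0, 1}, {1, 2}, {0, 2}}"
proof -
  have "e = {0, 1} \<or> e = {1, 2} \<or> e = {0, 2}" if e: "e \<subseteq> {..<3}" "card e = 2" for e :: "nat set"
  proof -
    obtain x y where xy: "e = {x, y}" "x \<noteq> y" using e(2) by (auto simp: card_2_iff)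
    then have "x \<in> {0, 1, 2}" "y \<in> {0, 1, 2}" using e(1) by auto
    then show ?thesis using xy by (auto simp: doubleton_eq_iff)
  qed
  then show ?thesis by (auto simp: complete_graph_def)
qed

text \<open>Every copy is the image of an ordered triple. Several orderings give the same copy,
  which is harmless for an upper bound.\<close>

lemma card_triangle_copies_le:
  assumes "simple_graph G"
  shows "card (copies (complete_graph 3) G) \<le> card (triangles (verts G) (\<lambda>u v. {u, v} \<in> edges G))"
proof -
  define h where "h = (\<lambda>(a :: 'a, b, c). \<lparr>verts = {a, b, c}, edges = {{a, b}, {b, c}, {a, c}}\<rparr>)"
  let ?T = "triangles (verts G) (\<lambda>u v. {u, v} \<in> edges G)"
  have "copies (complete_graph 3) G \<subseteq> h ` ?T"
  proof
    fix S assume "S \<in> copies (complete_graph 3) G"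
    then obtain f where S: "verts S \<subseteq> verts G" "edges S \<subseteq> edges G"
      and f: "bij_betw f (verts (complete_graph 3)) (verts S)" "edges S = (\<lambda>e. f ` e) ` edges (complete_graph 3)"
      by (auto simp: copies_def subgraph_def isomorphic_def)
    have "verts (complete_graph 3) = {0, 1, 2}" by (auto simp: complete_graph_def)
    then have vS: "verts S = {f 0, f 1, f 2}" using f(1) by (auto simp: bij_betw_def)
    have eS: "edges S = {{f 0, f 1}, {f 1, f 2}, {f 0, f 2}}"
      unfolding f(2) edges_complete_graph_3 by simp
    have "S = h (f 0, f 1, f 2)"
      using vS eS by (simp add: h_def)
    moreover have "(f 0, f 1, f 2) \<in> ?T"
      using S vS eS by (simp add: triangles_def)
    ultimately show "S \<in> h ` ?T" by (rule image_eqI)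
  qed
  moreover have "finite ?T"
    using assms by (intro finite_triangles) (simp add: simple_graph_def)
  ultimately show ?thesis by (meson card_image_le card_mono finite_imageI le_trans)
qed

text \<open>The added vertex \<open>None\<close> goes to \<open>v\<close> and the cycle to the list
  of link vertices. The map is injective because a simple graph has no loop, so \<open>v\<close> is
  not in its own link.\<close>

lemma suspension_copy_of_link_cycle:
  assumes G: "simple_graph G" and "v \<in> verts G" and "3 \<le> m"
    and cyc: "has_cycle {u\<in>verts G. {v, u} \<in> edges G} (\<lambda>x y. {x, y} \<in> edges G) m"
  shows "contains_copy G (suspension (cycle_graph m))"
proof -
  obtain xs where xs: "length xs = m" "distinct xs" "set xs \<subseteq> {u\<in>verts G. {v, u} \<in> edges G}"
    "successively (\<lambda>x y. {x, y} \<in> edges G) xs" "{last xs, hd xs} \<in> edges G"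
    using cyc unfolding has_cycle_def by blast
  let ?H = "suspension (cycle_graph m)"
  define f where "f = case_option v (\<lambda>i. xs ! i)"
  define S where "S = \<lparr>verts = f ` verts ?H, edges = (\<lambda>e. f ` e) ` edges ?H\<rparr>"
  have H: "simple_graph ?H"
    using assms(3) by (intro simple_graph_suspension simple_graph_cycle_graph)
  have nth: "xs ! i \<in> verts G" "{v, xs ! i} \<in> edges G" if "i < m" for i
    using xs(1,3) that nth_mem by blast+
  have "v \<notin> set xs"
  proof
    assume "v \<in> set xs"
    then have "{v, v} \<in> edges G" using xs(3) by blast
    then have "card {v, v} = 2" using G unfolding simple_graph_def by blast
    then show False by simp
  qed
  have vH: "verts ?H = insert None (Some ` {..<m})"
    by (simp add: suspension_def cycle_graph_def)
  have "inj_on f (verts ?H)"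
    unfolding vH f_def using xs(1,2) \<open>v \<notin> set xs\<close>
    by (auto simp: inj_on_def nth_eq_iff_index_eq)
  then have iso: "isomorphic ?H S"
    unfolding isomorphic_def S_def by (intro exI[of _ f]) (simp add: bij_betw_def)
  have verts: "verts S \<subseteq> verts G"
    using nth(1) assms(2) by (auto simp: S_def vH f_def)
  have edges: "edges S \<subseteq> edges G"
  proof
    fix e assume "e \<in> edges S"
    then obtain e' where e': "e' \<in> edges ?H" "e = f ` e'" by (auto simp: S_def)
    then consider i where "i < m" "e' = {Some i, Some ((i + 1) mod m)}" | i where "i < m" "e' = {None, Some i}"
      by (auto simp: suspension_def cycle_graph_def)
    then show "e \<in> edges G"
    proof cases
      case 1
      then have e: "e = {xs ! i, xs ! ((i + 1) mod m)}" by (simp add: e'(2) f_def)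
      show ?thesis
      \<comment> \<open>At the last index the successor wraps around to 0, and the edge is the one
        that closes the list.\<close>
      proof (cases "i + 1 = m")
        case True
        then have "xs \<noteq> []" "i = length xs - 1" using xs(1) by auto
        moreover have "e = {xs ! i, xs ! 0}" using True by (simp add: e)
        ultimately have "e = {last xs, hd xs}" by (simp add: last_conv_nth hd_conv_nth)
        then show ?thesis using xs(5) by simp
      next
        case False
        then have "Suc i < length xs" using 1 xs(1) by simp
        then have "{xs ! i, xs ! Suc i} \<in> edges G"
          using xs(4) by (auto simp: successively_conv_nth)
        then show ?thesis using \<open>Suc i < length xs\<close> xs(1) by (simp add: e)
      qed
    next
      case 2
      then show ?thesis using nth(2) by (simp add: e'(2) f_def)
    qed
  qed
  have "simple_graph S"
    unfolding simple_graph_def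
  proof (intro conjI ballI)
    show "finite (verts S)" using H by (simp add: S_def simple_graph_def)
    fix e assume e: "e \<in> edges S"
    then show "card e = 2" using edges G by (auto simp: simple_graph_def)
    show "e \<subseteq> verts S" using e H by (auto simp: S_def simple_graph_def)
  qed
  then have "S \<in> copies ?H G"
    using verts edges iso by (simp add: copies_def subgraph_def)
  then show ?thesis by (auto simp: contains_copy_def)
qed

theorem theorem1p2:
  fixes k :: nat
  assumes "k \<ge> 2"
  shows "(\<lambda>n. real (gen_turan n (complete_graph 3) (suspension (cycle_graph (2 * k)))))
           \<in> o(\<lambda>n. real n powr (2 + 1 / real k))"
proof (rule landau_o.smallI)
  fix c :: real assume "0 < c"
  let ?H = "suspension (cycle_graph (2 * k))"
  obtain N where N: "\<And>(V :: nat set) E. finite V \<Longrightarrow> symp E \<Longrightarrow> irreflp E \<Longrightarrow> N \<le> card V \<Longrightarrow>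
    \<forall>v\<in>V. \<not> has_cycle {u\<in>V. E v u} E (2 * k) \<Longrightarrow>
    real (card (triangles V E)) \<le> c * ((real (card V))\<^sup>2 * real (card V) powr (1 / real k))"
    using even_cycle_free_links_imp_few_triangles[OF assms \<open>0 < c\<close>, where ?'a = nat] by blast
  have "real (gen_turan n (complete_graph 3) ?H) \<le> c * real n powr (2 + 1 / real k)" if n: "max N 1 \<le> n" for n
  proof -
    let ?A = "{card (copies (complete_graph 3) G) | G :: nat ugraph.
             simple_graph G \<and> card (verts G) = n \<and> \<not> contains_copy G ?H}"
    have "edges ?H \<noteq> {}" using assms by (auto simp: suspension_def cycle_graph_def intro: exI[of _ 0])
    \<comment> \<open>The maximum is attained, so the triangle bound can be applied to an extremal
      graph.\<close>
    then have "Max ?A \<in> ?A"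
      by (intro Max_in gen_turan_well_defined)
    then obtain G :: "nat ugraph" where G: "simple_graph G" "card (verts G) = n" "\<not> contains_copy G ?H"
      "gen_turan n (complete_graph 3) ?H = card (copies (complete_graph 3) G)"
      unfolding gen_turan_def by blast
    define E where "E = (\<lambda>u v. {u, v} \<in> edges G)"
    have "card (triangles (verts G) E) \<le> c * ((real (card (verts G)))\<^sup>2 * real (card (verts G)) powr (1 / real k))"
    proof (rule N)
      show "finite (verts G)" using G(1) by (simp add: simple_graph_def)
      show "symp E" by (auto simp: E_def symp_def insert_commute)
      show "irreflp E" using G(1) by (auto simp: E_def irreflp_def simple_graph_def)
      show "N \<le> card (verts G)" using n G(2) by simp
      show "\<forall>v\<in>verts G. \<not> has_cycle {u\<in>verts G. E v u} E (2 * k)"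
        using suspension_copy_of_link_cycle[OF G(1), of _ "2 * k"] G(3) assms unfolding E_def by auto
    qed
    moreover have "gen_turan n (complete_graph 3) ?H \<le> card (triangles (verts G) E)"
      unfolding G(4) E_def by (rule card_triangle_copies_le[OF G(1)])
    moreover have "real n powr (2 + 1 / real k) = (real n)\<^sup>2 * real n powr (1 / real k)"
      using n by (simp add: powr_add)
    ultimately show ?thesis using G(2) by simp
  qed
  then show "\<forall>\<^sub>F n in sequentially. norm (real (gen_turan n (complete_graph 3) ?H))
      \<le> c * norm (real n powr (2 + 1 / real k))"
    by (intro eventually_sequentiallyI[of "max N 1"]) simp
qed

end
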